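(* Let $R$ be a commutative Noetherian ring, $\mathfrak a$ a proper ideal of $R$, and $M$ a faithful multiplication $R$-module. Then $M$ is relative Cohen-Macaulay with respect to $\mathfrak a$ if and only if $R$ is relative Cohen-Macaulay with respect to $\mathfrak a$.
   Context: An $R$-module $M$ is called multiplication if for every submodule $N$ of $M$ there exists an ideal $I$ of $R$ such that $N=IM$; it is faithful multiplication if moreover $\operatorname{Ann}_RM=0$. A finitely generated $R$-module $M$ is relative Cohen-Macaulay with respect to $\mathfrak a$ if there is precisely one $i$ with $H^i_{\mathfrak a}(M)\ne0$ (local cohomology with respect to $\mathfrak a$); equivalently, $\operatorname{grade}(\mathfrak a,M)=\operatorname{cd}(\mathfrak a,M)$, where $\operatorname{cd}(\mathfrak a,M)=\sup\{i\mid H^i_{\mathfrak a}(M)\neq0\}$. *)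

theory Defs
  imports
    "HOL-Algebra.Module"
    "HOL-Algebra.Ideal_Product"
    "HOL-Algebra.Ring_Divisibility"
begin

section \<open>Module constructions\<close>

text \<open>The record type of modules extends that of rings; the multiplicative part of the record is
  irrelevant for modules and is filled with dummy values.\<close>

definition make_module ::
    "'b set \<Rightarrow> 'b \<Rightarrow> ('b \<Rightarrow> 'b \<Rightarrow> 'b) \<Rightarrow> ('a \<Rightarrow> 'b \<Rightarrow> 'b) \<Rightarrow> ('a, 'b) module"
  where "make_module C z p s =
    \<lparr>carrier = C, monoid.mult = (\<lambda>_ _. z), one = z, zero = z, add = p, smult = s\<rparr>"

definition self_module :: "('a, 'c) ring_scheme \<Rightarrow> ('a, 'a) module"
  where "self_module R = make_module (carrier R) \<zero>\<^bsub>R\<^esub> (add R) (\<lambda>r x. r \<otimes>\<^bsub>R\<^esub> x)"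

definition quotient_module :: "('a, 'b, 'd) module_scheme \<Rightarrow> 'b set \<Rightarrow> ('a, 'b set) module"
  where "quotient_module M N = make_module (a_rcosets\<^bsub>M\<^esub> N) N (set_add M)
    (\<lambda>r X. \<Union>x\<in>X. N +>\<^bsub>M\<^esub> (r \<odot>\<^bsub>M\<^esub> x))"

definition free_module :: "('a, 'c) ring_scheme \<Rightarrow> nat \<Rightarrow> ('a, nat \<Rightarrow> 'a) module"
  where "free_module R n = make_module ({..<n} \<rightarrow>\<^sub>E carrier R) (\<lambda>i\<in>{..<n}. \<zero>\<^bsub>R\<^esub>)
    (\<lambda>x y. \<lambda>i\<in>{..<n}. x i \<oplus>\<^bsub>R\<^esub> y i) (\<lambda>r x. \<lambda>i\<in>{..<n}. r \<otimes>\<^bsub>R\<^esub> x i)"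

definition module_homs ::
    "('a, 'c) ring_scheme \<Rightarrow> ('a, 'b, 'd) module_scheme \<Rightarrow> ('a, 'e, 'f) module_scheme \<Rightarrow> ('b \<Rightarrow> 'e) set"
  where "module_homs R M N = {h \<in> carrier M \<rightarrow>\<^sub>E carrier N.
    (\<forall>x\<in>carrier M. \<forall>y\<in>carrier M. h (x \<oplus>\<^bsub>M\<^esub> y) = h x \<oplus>\<^bsub>N\<^esub> h y) \<and>
    (\<forall>r\<in>carrier R. \<forall>x\<in>carrier M. h (r \<odot>\<^bsub>M\<^esub> x) = r \<odot>\<^bsub>N\<^esub> h x)}"

definition hom_module ::
    "('a, 'c) ring_scheme \<Rightarrow> ('a, 'b, 'd) module_scheme \<Rightarrow> ('a, 'e, 'f) module_scheme \<Rightarrow>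
      ('a, 'b \<Rightarrow> 'e) module"
  where "hom_module R M N = make_module (module_homs R M N) (\<lambda>x\<in>carrier M. \<zero>\<^bsub>N\<^esub>)
    (\<lambda>g h. \<lambda>x\<in>carrier M. g x \<oplus>\<^bsub>N\<^esub> h x) (\<lambda>r h. \<lambda>x\<in>carrier M. r \<odot>\<^bsub>N\<^esub> h x)"

definition zero_module :: "('a, 'b, 'd) module_scheme \<Rightarrow> bool"
  where "zero_module M \<longleftrightarrow> carrier M = {\<zero>\<^bsub>M\<^esub>}"

definition fin_gen_module :: "('a, 'c) ring_scheme \<Rightarrow> ('a, 'b, 'd) module_scheme \<Rightarrow> bool"
  where "fin_gen_module R M \<longleftrightarrow>
    (\<exists>A \<subseteq> carrier M. finite A \<and> (\<forall>N. submodule N R M \<longrightarrow> A \<subseteq> N \<longrightarrow> N = carrier M))"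


section \<open>Multiplication modules\<close>

text \<open>The submodule \<open>I M\<close>, in the style of \<^const>\<open>ideal_prod\<close>.\<close>

inductive_set ideal_smult ::
    "('a, 'c) ring_scheme \<Rightarrow> 'a set \<Rightarrow> ('a, 'b, 'd) module_scheme \<Rightarrow> 'b set"
  for R and I and M where
    smult: "\<lbrakk>r \<in> I; x \<in> carrier M\<rbrakk> \<Longrightarrow> r \<odot>\<^bsub>M\<^esub> x \<in> ideal_smult R I M"
  | sum: "\<lbrakk>x \<in> ideal_smult R I M; y \<in> ideal_smult R I M\<rbrakk> \<Longrightarrow> x \<oplus>\<^bsub>M\<^esub> y \<in> ideal_smult R I M"

definition multiplication_module :: "('a, 'c) ring_scheme \<Rightarrow> ('a, 'b, 'd) module_scheme \<Rightarrow> bool"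
  where "multiplication_module R M \<longleftrightarrow>
    module R M \<and> (\<forall>N. submodule N R M \<longrightarrow> (\<exists>I. ideal I R \<and> N = ideal_smult R I M))"

definition annihilator :: "('a, 'c) ring_scheme \<Rightarrow> ('a, 'b, 'd) module_scheme \<Rightarrow> 'a set"
  where "annihilator R M = {r \<in> carrier R. \<forall>x\<in>carrier M. r \<odot>\<^bsub>M\<^esub> x = \<zero>\<^bsub>M\<^esub>}"

definition faithful_multiplication_module ::
    "('a, 'c) ring_scheme \<Rightarrow> ('a, 'b, 'd) module_scheme \<Rightarrow> bool"
  where "faithful_multiplication_module R M \<longleftrightarrow>
    multiplication_module R M \<and> annihilator R M = {\<zero>\<^bsub>R\<^esub>}"


section \<open>Ext modules\<close>

text \<open>Over a Noetherian ring every finitely generated module has a resolution by free modules of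
  finite rank (\<open>free_resolution_exists\<close> below), so \<open>Ext(N, M)\<close> for finitely generated \<open>N\<close>
  can be computed from such a resolution of \<open>N\<close>.\<close>

record ('a, 'n) resolution =
  rank :: "nat \<Rightarrow> nat"
  diff :: "nat \<Rightarrow> (nat \<Rightarrow> 'a) \<Rightarrow> nat \<Rightarrow> 'a"
  aug :: "(nat \<Rightarrow> 'a) \<Rightarrow> 'n"

abbreviation res_module ::
    "('a, 'c) ring_scheme \<Rightarrow> ('a, 'n) resolution \<Rightarrow> nat \<Rightarrow> ('a, nat \<Rightarrow> 'a) module"
  where "res_module R P k \<equiv> free_module R (rank P k)"

definition free_resolution ::
    "('a, 'c) ring_scheme \<Rightarrow> ('a, 'n, 'd) module_scheme \<Rightarrow> ('a, 'n) resolution \<Rightarrow> bool"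
  where "free_resolution R N P \<longleftrightarrow>
    aug P \<in> module_homs R (res_module R P 0) N \<and>
    (\<forall>k. diff P k \<in> module_homs R (res_module R P (Suc k)) (res_module R P k)) \<and>
    aug P ` carrier (res_module R P 0) = carrier N \<and>
    diff P 0 ` carrier (res_module R P 1) = a_kernel (res_module R P 0) N (aug P) \<and>
    (\<forall>k. diff P (Suc k) ` carrier (res_module R P (Suc (Suc k))) =
       a_kernel (res_module R P (Suc k)) (res_module R P k) (diff P k))"

definition the_resolution ::
    "('a, 'c) ring_scheme \<Rightarrow> ('a, 'n, 'd) module_scheme \<Rightarrow> ('a, 'n) resolution"
  where "the_resolution R N = (SOME P. free_resolution R N P)"

text \<open>Chain maps between resolutions of \<open>N'\<close> and \<open>N\<close> lifting \<open>h : N' \<rightarrow> N\<close>.\<close>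

definition chain_lift ::
    "('a, 'c) ring_scheme \<Rightarrow> ('a, 'm) resolution \<Rightarrow> ('a, 'n) resolution \<Rightarrow> ('m \<Rightarrow> 'n) \<Rightarrow>
      (nat \<Rightarrow> (nat \<Rightarrow> 'a) \<Rightarrow> nat \<Rightarrow> 'a) \<Rightarrow> bool"
  where "chain_lift R P' P h \<phi> \<longleftrightarrow>
    (\<forall>k. \<phi> k \<in> module_homs R (res_module R P' k) (res_module R P k)) \<and>
    (\<forall>x\<in>carrier (res_module R P' 0). aug P (\<phi> 0 x) = h (aug P' x)) \<and>
    (\<forall>k. \<forall>x\<in>carrier (res_module R P' (Suc k)). diff P k (\<phi> (Suc k) x) = \<phi> k (diff P' k x))"

definition the_lift ::
    "('a, 'c) ring_scheme \<Rightarrow> ('a, 'm) resolution \<Rightarrow> ('a, 'n) resolution \<Rightarrow> ('m \<Rightarrow> 'n) \<Rightarrow>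
      nat \<Rightarrow> (nat \<Rightarrow> 'a) \<Rightarrow> nat \<Rightarrow> 'a"
  where "the_lift R P' P h = (SOME \<phi>. chain_lift R P' P h \<phi>)"

definition cochains ::
    "('a, 'c) ring_scheme \<Rightarrow> ('a, 'n) resolution \<Rightarrow> ('a, 'b, 'd) module_scheme \<Rightarrow> nat \<Rightarrow>
      ('a, (nat \<Rightarrow> 'a) \<Rightarrow> 'b) module"
  where "cochains R P M i = hom_module R (res_module R P i) M"

definition codiff ::
    "('a, 'c) ring_scheme \<Rightarrow> ('a, 'n) resolution \<Rightarrow> nat \<Rightarrow> ((nat \<Rightarrow> 'a) \<Rightarrow> 'b) \<Rightarrow> (nat \<Rightarrow> 'a) \<Rightarrow> 'b"
  where "codiff R P i z = (\<lambda>x\<in>carrier (res_module R P (Suc i)). z (diff P i x))"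

definition cocycles ::
    "('a, 'c) ring_scheme \<Rightarrow> ('a, 'n) resolution \<Rightarrow> ('a, 'b, 'd) module_scheme \<Rightarrow> nat \<Rightarrow>
      ((nat \<Rightarrow> 'a) \<Rightarrow> 'b) set"
  where "cocycles R P M i =
    a_kernel (cochains R P M i) (cochains R P M (Suc i)) (codiff R P i)"

definition coboundaries ::
    "('a, 'c) ring_scheme \<Rightarrow> ('a, 'n) resolution \<Rightarrow> ('a, 'b, 'd) module_scheme \<Rightarrow> nat \<Rightarrow>
      ((nat \<Rightarrow> 'a) \<Rightarrow> 'b) set"
  where "coboundaries R P M i = (case i of
      0 \<Rightarrow> {\<zero>\<^bsub>cochains R P M 0\<^esub>}
    | Suc j \<Rightarrow> codiff R P j ` carrier (cochains R P M j))"

definition Ext ::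
    "('a, 'c) ring_scheme \<Rightarrow> nat \<Rightarrow> ('a, 'n, 'e) module_scheme \<Rightarrow> ('a, 'b, 'd) module_scheme \<Rightarrow>
      ('a, ((nat \<Rightarrow> 'a) \<Rightarrow> 'b) set) module"
  where "Ext R i N M = (let P = the_resolution R N in
    quotient_module ((cochains R P M i)\<lparr>carrier := cocycles R P M i\<rparr>) (coboundaries R P M i))"

text \<open>The map \<open>Ext R i N M \<rightarrow> Ext R i N' M\<close> induced by \<open>h : N' \<rightarrow> N\<close>; the union over the
  representatives \<open>z\<close> of the class \<open>X\<close> is a union of equal cosets.\<close>

definition Ext_map ::
    "('a, 'c) ring_scheme \<Rightarrow> nat \<Rightarrow> ('a, 'm, 'f) module_scheme \<Rightarrow> ('a, 'n, 'e) module_scheme \<Rightarrow>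
      ('a, 'b, 'd) module_scheme \<Rightarrow> ('m \<Rightarrow> 'n) \<Rightarrow>
      ((nat \<Rightarrow> 'a) \<Rightarrow> 'b) set \<Rightarrow> ((nat \<Rightarrow> 'a) \<Rightarrow> 'b) set"
  where "Ext_map R i N' N M h X = (let P' = the_resolution R N'; P = the_resolution R N in
    \<Union>z\<in>X. coboundaries R P' M i +>\<^bsub>cochains R P' M i\<^esub>
      (\<lambda>x\<in>carrier (res_module R P' i). z (the_lift R P' P h i x)))"


section \<open>Direct limits of sequences of modules\<close>

text \<open>\<open>transition f n j\<close> is the composite of \<open>f n, \<dots>, f (n + j - 1)\<close>, from stage \<open>n\<close> to stage
  \<open>n + j\<close>.\<close>

primrec transition :: "(nat \<Rightarrow> 'b \<Rightarrow> 'b) \<Rightarrow> nat \<Rightarrow> nat \<Rightarrow> 'b \<Rightarrow> 'b" where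
  "transition f n 0 x = x"
| "transition f n (Suc j) x = f (n + j) (transition f n j x)"

definition limit_class ::
    "(nat \<Rightarrow> ('a, 'b, 'd) module_scheme) \<Rightarrow> (nat \<Rightarrow> 'b \<Rightarrow> 'b) \<Rightarrow> nat \<Rightarrow> 'b \<Rightarrow> (nat \<times> 'b) set"
  where "limit_class E f n x = {(m, y). y \<in> carrier (E m) \<and>
    (\<exists>i j. n + i = m + j \<and> transition f n i x = transition f m j y)}"

definition direct_limit ::
    "(nat \<Rightarrow> ('a, 'b, 'd) module_scheme) \<Rightarrow> (nat \<Rightarrow> 'b \<Rightarrow> 'b) \<Rightarrow> ('a, (nat \<times> 'b) set) module"
  where "direct_limit E f = make_module
    (\<Union>n. limit_class E f n ` carrier (E n))
    (limit_class E f 0 \<zero>\<^bsub>E 0\<^esub>)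
    (\<lambda>X Y. \<Union>(n, x)\<in>X. \<Union>(m, y)\<in>Y.
       limit_class E f (n + m) (transition f n m x \<oplus>\<^bsub>E (n + m)\<^esub> transition f m n y))
    (\<lambda>r X. \<Union>(n, x)\<in>X. limit_class E f n (r \<odot>\<^bsub>E n\<^esub> x))"


section \<open>Local cohomology and relative Cohen-Macaulay modules\<close>

definition power_quotient :: "('a, 'c) ring_scheme \<Rightarrow> 'a set \<Rightarrow> nat \<Rightarrow> ('a, 'a set) module"
  where "power_quotient R \<aa> n = quotient_module (self_module R) (\<aa> [^]\<^bsub>ideals_set R\<^esub> n)"

definition power_proj :: "('a, 'c) ring_scheme \<Rightarrow> 'a set \<Rightarrow> nat \<Rightarrow> 'a set \<Rightarrow> 'a set"
  where "power_proj R \<aa> n =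
    (\<lambda>X\<in>carrier (power_quotient R \<aa> (Suc n)). \<Union>x\<in>X. (\<aa> [^]\<^bsub>ideals_set R\<^esub> n) +>\<^bsub>R\<^esub> x)"

text \<open>The \<open>i\<close>-th local cohomology module of \<open>M\<close> with respect to \<open>\<aa>\<close> is the direct limit over \<open>n\<close>
  of the modules \<open>Ext\<^sup>i(R/\<aa>\<^sup>n, M)\<close> along the maps induced by the projections
  \<open>R/\<aa>\<^sup>n\<^sup>+\<^sup>1 \<rightarrow> R/\<aa>\<^sup>n\<close>.\<close>

definition local_cohomology ::
    "('a, 'c) ring_scheme \<Rightarrow> 'a set \<Rightarrow> nat \<Rightarrow> ('a, 'b, 'd) module_scheme \<Rightarrow>
      ('a, (nat \<times> ((nat \<Rightarrow> 'a) \<Rightarrow> 'b) set) set) module"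
  where "local_cohomology R \<aa> i M = direct_limit
    (\<lambda>n. Ext R i (power_quotient R \<aa> n) M)
    (\<lambda>n. Ext_map R i (power_quotient R \<aa> (Suc n)) (power_quotient R \<aa> n) M (power_proj R \<aa> n))"

definition relative_cohen_macaulay ::
    "('a, 'c) ring_scheme \<Rightarrow> 'a set \<Rightarrow> ('a, 'b, 'd) module_scheme \<Rightarrow> bool"
  where "relative_cohen_macaulay R \<aa> M \<longleftrightarrow>
    module R M \<and> fin_gen_module R M \<and> (\<exists>!i. \<not> zero_module (local_cohomology R \<aa> i M))"


section \<open>Existence of the chosen resolutions and lifts\<close>

lemma make_module_simps [simp]:
  "carrier (make_module C z p s) = C" "zero (make_module C z p s) = z"
  "add (make_module C z p s) = p" "smult (make_module C z p s) = s"
  by (simp_all add: make_module_def)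

lemma free_module_simps:
  "carrier (free_module R n) = {..<n} \<rightarrow>\<^sub>E carrier R"
  "\<zero>\<^bsub>free_module R n\<^esub> = (\<lambda>i\<in>{..<n}. \<zero>\<^bsub>R\<^esub>)"
  "x \<oplus>\<^bsub>free_module R n\<^esub> y = (\<lambda>i\<in>{..<n}. x i \<oplus>\<^bsub>R\<^esub> y i)"
  "r \<odot>\<^bsub>free_module R n\<^esub> x = (\<lambda>i\<in>{..<n}. r \<otimes>\<^bsub>R\<^esub> x i)"
  by (simp_all add: free_module_def)

lemma module_self_module:
  fixes R (structure)
  assumes "cring R" shows "module R (self_module R)"
proof -
  interpret cring R by fact
  show ?thesis
    by (rule moduleI)
       (auto simp: self_module_def assms l_distr r_distr m_assoc intro!: abelian_groupI a_assoc a_comm l_neg)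
qed

lemma free_module_nth:
  "x \<in> carrier (free_module R n) \<Longrightarrow> i < n \<Longrightarrow> x i \<in> carrier R"
  by (simp add: free_module_simps PiE_iff)

lemma free_module_eqI:
  assumes "x \<in> carrier (free_module R n)" "y \<in> carrier (free_module R n)" "\<And>i. i < n \<Longrightarrow> x i = y i"
  shows "x = y"
  using assms by (intro PiE_ext[of x "{..<n}" "\<lambda>_. carrier R" y]) (auto simp: free_module_simps)

lemma module_free_module:
  fixes R (structure)
  assumes "cring R" shows "module R (free_module R n)"
proof -
  interpret cring R by fact
  let ?F = "free_module R n"
  note nth = free_module_nth[of _ R n]
  have cl: "x \<oplus>\<^bsub>?F\<^esub> y \<in> carrier ?F" "\<zero>\<^bsub>?F\<^esub> \<in> carrier ?F"
    if "x \<in> carrier ?F" "y \<in> carrier ?F" for x y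
    using nth[OF that(1)] nth[OF that(2)] by (simp_all add: free_module_simps)
  have z: "\<zero>\<^bsub>?F\<^esub> \<in> carrier ?F" by (simp add: free_module_simps)
  have sm: "r \<odot>\<^bsub>?F\<^esub> x \<in> carrier ?F" if "r \<in> carrier R" "x \<in> carrier ?F" for r x
    using nth[OF that(2)] that(1) by (simp add: free_module_simps)
  have at: "i < n \<Longrightarrow> (x \<oplus>\<^bsub>?F\<^esub> y) i = x i \<oplus> y i" "i < n \<Longrightarrow> (r \<odot>\<^bsub>?F\<^esub> x) i = r \<otimes> x i"
    "i < n \<Longrightarrow> \<zero>\<^bsub>?F\<^esub> i = \<zero>" for x y r i
    by (simp_all add: free_module_simps)
  have "abelian_group ?F"
  proof (rule abelian_groupI)
    fix x assume x: "x \<in> carrier ?F"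
    show "\<exists>y\<in>carrier ?F. y \<oplus>\<^bsub>?F\<^esub> x = \<zero>\<^bsub>?F\<^esub>"
    proof (rule bexI[of _ "(\<ominus> \<one>) \<odot>\<^bsub>?F\<^esub> x"])
      show "(\<ominus> \<one>) \<odot>\<^bsub>?F\<^esub> x \<oplus>\<^bsub>?F\<^esub> x = \<zero>\<^bsub>?F\<^esub>"
        by (rule free_module_eqI[of _ R n]) (simp_all add: cl z sm x at nth l_minus l_neg)
    qed (simp add: sm x)
    show "\<zero>\<^bsub>?F\<^esub> \<oplus>\<^bsub>?F\<^esub> x = x"
      by (rule free_module_eqI[of _ R n]) (simp_all add: cl z x at nth)
    fix y assume y: "y \<in> carrier ?F"
    show "x \<oplus>\<^bsub>?F\<^esub> y \<in> carrier ?F" by (rule cl[OF x y])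
    show "x \<oplus>\<^bsub>?F\<^esub> y = y \<oplus>\<^bsub>?F\<^esub> x"
      by (rule free_module_eqI[of _ R n]) (simp_all add: cl x y at nth a_comm)
    fix w assume w: "w \<in> carrier ?F"
    show "(x \<oplus>\<^bsub>?F\<^esub> y) \<oplus>\<^bsub>?F\<^esub> w = x \<oplus>\<^bsub>?F\<^esub> (y \<oplus>\<^bsub>?F\<^esub> w)"
      by (rule free_module_eqI[of _ R n]) (simp_all add: cl x y w at nth a_assoc)
  qed (rule z)
  then show ?thesis
    by (intro moduleI assms sm free_module_eqI[of _ R n])
       (simp_all add: cl sm at nth l_distr r_distr m_assoc)
qed

lemma module_homI:
  assumes "h \<in> carrier M \<rightarrow>\<^sub>E carrier N"
    and "\<And>x y. x \<in> carrier M \<Longrightarrow> y \<in> carrier M \<Longrightarrow> h (x \<oplus>\<^bsub>M\<^esub> y) = h x \<oplus>\<^bsub>N\<^esub> h y"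
    and "\<And>r x. r \<in> carrier R \<Longrightarrow> x \<in> carrier M \<Longrightarrow> h (r \<odot>\<^bsub>M\<^esub> x) = r \<odot>\<^bsub>N\<^esub> h x"
  shows "h \<in> module_homs R M N"
  using assms by (auto simp: module_homs_def)

lemma module_homD:
  assumes "h \<in> module_homs R M N"
  shows "x \<in> carrier M \<Longrightarrow> h x \<in> carrier N"
    and "x \<in> carrier M \<Longrightarrow> y \<in> carrier M \<Longrightarrow> h (x \<oplus>\<^bsub>M\<^esub> y) = h x \<oplus>\<^bsub>N\<^esub> h y"
    and "r \<in> carrier R \<Longrightarrow> x \<in> carrier M \<Longrightarrow> h (r \<odot>\<^bsub>M\<^esub> x) = r \<odot>\<^bsub>N\<^esub> h x"
  using assms by (auto simp: module_homs_def)

lemma module_hom_zero: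
  assumes "module R M" "module R N" "h \<in> module_homs R M N"
  shows "h \<zero>\<^bsub>M\<^esub> = \<zero>\<^bsub>N\<^esub>"
proof -
  interpret M: module R M by fact
  interpret N: module R N by fact
  have "h (\<zero>\<^bsub>R\<^esub> \<odot>\<^bsub>M\<^esub> \<zero>\<^bsub>M\<^esub>) = \<zero>\<^bsub>R\<^esub> \<odot>\<^bsub>N\<^esub> h \<zero>\<^bsub>M\<^esub>"
    using module_homD(3)[OF assms(3)] by blast
  then show ?thesis using module_homD(1)[OF assms(3), of "\<zero>\<^bsub>M\<^esub>"] by simp
qed

lemma submoduleI':
  fixes R (structure)
  assumes "module R M" "H \<subseteq> carrier M" "\<zero>\<^bsub>M\<^esub> \<in> H"
    and "\<And>x y. x \<in> H \<Longrightarrow> y \<in> H \<Longrightarrow> x \<oplus>\<^bsub>M\<^esub> y \<in> H"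
    and "\<And>r x. r \<in> carrier R \<Longrightarrow> x \<in> H \<Longrightarrow> r \<odot>\<^bsub>M\<^esub> x \<in> H"
  shows "submodule H R M"
proof -
  interpret module R M by fact
  show ?thesis
  proof (rule submoduleI)
    fix a assume a: "a \<in> H"
    then have ac: "a \<in> carrier M" using assms by auto
    have "(\<ominus>\<^bsub>R\<^esub> \<one>\<^bsub>R\<^esub>) \<odot>\<^bsub>M\<^esub> a \<in> H" using a assms(5) by auto
    then show "\<ominus>\<^bsub>M\<^esub> a \<in> H" using ac by (simp add: smult_l_minus)
  qed (use assms in auto)
qed

lemma submoduleD:
  assumes "module R M" "submodule H R M"
  shows "H \<subseteq> carrier M" "\<zero>\<^bsub>M\<^esub> \<in> H"
    "x \<in> H \<Longrightarrow> y \<in> H \<Longrightarrow> x \<oplus>\<^bsub>M\<^esub> y \<in> H"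
    "r \<in> carrier R \<Longrightarrow> x \<in> H \<Longrightarrow> r \<odot>\<^bsub>M\<^esub> x \<in> H"
    "x \<in> H \<Longrightarrow> \<ominus>\<^bsub>M\<^esub> x \<in> H"
proof -
  interpret module R M by fact
  show "H \<subseteq> carrier M" "x \<in> H \<Longrightarrow> y \<in> H \<Longrightarrow> x \<oplus>\<^bsub>M\<^esub> y \<in> H"
    "r \<in> carrier R \<Longrightarrow> x \<in> H \<Longrightarrow> r \<odot>\<^bsub>M\<^esub> x \<in> H" "x \<in> H \<Longrightarrow> \<ominus>\<^bsub>M\<^esub> x \<in> H"
    using submoduleE[OF assms(2)] by auto
  show "\<zero>\<^bsub>M\<^esub> \<in> H" using subgroup.one_closed[OF submodule.axioms(1)[OF assms(2)]] by simp
qed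

lemma submodule_kernel:
  assumes "module R M" "module R N" "h \<in> module_homs R M N"
  shows "submodule (a_kernel M N h) R M"
proof -
  interpret M: module R M by fact
  interpret N: module R N by fact
  show ?thesis
    by (rule submoduleI'[OF assms(1)])
       (auto simp: a_kernel_def kernel_def module_homD[OF assms(3)] module_hom_zero[OF assms])
qed

lemma submodule_image:
  assumes "module R M" "module R N" "h \<in> module_homs R M N"
  shows "submodule (h ` carrier M) R N"
proof -
  interpret M: module R M by fact
  interpret N: module R N by fact
  show ?thesis
  proof (rule submoduleI'[OF assms(2)])
    show "h ` carrier M \<subseteq> carrier N" using module_homD(1)[OF assms(3)] by auto
    show "\<zero>\<^bsub>N\<^esub> \<in> h ` carrier M" using module_hom_zero[OF assms] M.M.zero_closed by (metis imageI)
  next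
    fix x y assume "x \<in> h ` carrier M" "y \<in> h ` carrier M"
    then obtain u v where "u \<in> carrier M" "v \<in> carrier M" "x = h u" "y = h v" by auto
    then show "x \<oplus>\<^bsub>N\<^esub> y \<in> h ` carrier M"
      using module_homD(2)[OF assms(3)] by (metis M.M.add.m_closed imageI)
  next
    fix r x assume r: "r \<in> carrier R" and "x \<in> h ` carrier M"
    then obtain u where "u \<in> carrier M" "x = h u" by auto
    then show "r \<odot>\<^bsub>N\<^esub> x \<in> h ` carrier M"
      using module_homD(3)[OF assms(3)] r by (metis M.smult_closed imageI)
  qed
qed

definition lin_comb where
  "lin_comb R N m g = (\<lambda>c\<in>carrier (free_module R m). \<Oplus>\<^bsub>N\<^esub>i\<in>{..<m}. c i \<odot>\<^bsub>N\<^esub> g i)"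

lemma lin_comb_hom:
  assumes "module R N" "g \<in> {..<m} \<rightarrow> carrier N"
  shows "lin_comb R N m g \<in> module_homs R (free_module R m) N"
proof -
  interpret N: module R N by fact
  interpret F: module R "free_module R m" by (rule module_free_module) (rule N.is_cring)
  have gi: "g i \<in> carrier N" if "i < m" for i using assms that by auto
  have ci: "c i \<in> carrier R" if "c \<in> carrier (free_module R m)" "i < m" for c i
    using that by (simp add: free_module_nth)
  show ?thesis
  proof (rule module_homI)
    show "lin_comb R N m g \<in> carrier (free_module R m) \<rightarrow>\<^sub>E carrier N"
      by (auto simp: lin_comb_def gi ci intro!: N.M.finsum_closed)
  next
    fix x y assume x: "x \<in> carrier (free_module R m)" and y: "y \<in> carrier (free_module R m)"
    have "(\<Oplus>\<^bsub>N\<^esub>i\<in>{..<m}. (x \<oplus>\<^bsub>free_module R m\<^esub> y) i \<odot>\<^bsub>N\<^esub> g i)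
        = (\<Oplus>\<^bsub>N\<^esub>i\<in>{..<m}. x i \<odot>\<^bsub>N\<^esub> g i \<oplus>\<^bsub>N\<^esub> y i \<odot>\<^bsub>N\<^esub> g i)"
      by (rule N.M.finsum_cong') (auto simp: free_module_simps(3) ci[OF x] ci[OF y] gi N.smult_l_distr)
    also have "\<dots> = (\<Oplus>\<^bsub>N\<^esub>i\<in>{..<m}. x i \<odot>\<^bsub>N\<^esub> g i) \<oplus>\<^bsub>N\<^esub> (\<Oplus>\<^bsub>N\<^esub>i\<in>{..<m}. y i \<odot>\<^bsub>N\<^esub> g i)"
      by (rule N.M.finsum_addf) (auto simp: ci[OF x] ci[OF y] gi)
    finally show "lin_comb R N m g (x \<oplus>\<^bsub>free_module R m\<^esub> y) = lin_comb R N m g x \<oplus>\<^bsub>N\<^esub> lin_comb R N m g y"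
      using x y by (simp add: lin_comb_def)
  next
    fix r x assume r: "r \<in> carrier R" and x: "x \<in> carrier (free_module R m)"
    have "(\<Oplus>\<^bsub>N\<^esub>i\<in>{..<m}. (r \<odot>\<^bsub>free_module R m\<^esub> x) i \<odot>\<^bsub>N\<^esub> g i)
        = (\<Oplus>\<^bsub>N\<^esub>i\<in>{..<m}. r \<odot>\<^bsub>N\<^esub> (x i \<odot>\<^bsub>N\<^esub> g i))"
      by (rule N.M.finsum_cong') (auto simp: free_module_simps(4) ci[OF x] r gi N.smult_assoc1)
    also have "\<dots> = r \<odot>\<^bsub>N\<^esub> (\<Oplus>\<^bsub>N\<^esub>i\<in>{..<m}. x i \<odot>\<^bsub>N\<^esub> g i)"
      by (rule N.finsum_smult_ldistr[symmetric]) (auto simp: ci[OF x] r gi)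
    finally show "lin_comb R N m g (r \<odot>\<^bsub>free_module R m\<^esub> x) = r \<odot>\<^bsub>N\<^esub> lin_comb R N m g x"
      using x r by (simp add: lin_comb_def)
  qed
qed

definition unit_vec where "unit_vec R m k = (\<lambda>i\<in>{..<m}. if i = k then \<one>\<^bsub>R\<^esub> else \<zero>\<^bsub>R\<^esub>)"

lemma unit_vec_closed: "cring R \<Longrightarrow> unit_vec R m k \<in> carrier (free_module R m)"
  by (auto simp: unit_vec_def free_module_simps cring.cring_simprules)

lemma lin_comb_unit_vec:
  assumes "module R N" "g \<in> {..<m} \<rightarrow> carrier N" "k < m"
  shows "lin_comb R N m g (unit_vec R m k) = g k"
proof -
  interpret N: module R N by fact
  have "(\<Oplus>\<^bsub>N\<^esub>i\<in>{..<m}. unit_vec R m k i \<odot>\<^bsub>N\<^esub> g i) = (\<Oplus>\<^bsub>N\<^esub>i\<in>{..<m}. if k = i then g i else \<zero>\<^bsub>N\<^esub>)"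
    using assms by (intro N.M.finsum_cong') (auto simp: unit_vec_def Pi_iff)
  also have "\<dots> = g k" using assms by (intro N.M.finsum_singleton) auto
  finally show ?thesis by (simp add: lin_comb_def unit_vec_closed N.is_cring)
qed

lemma free_module_induct:
  fixes R (structure)
  assumes "cring R" "submodule T R (free_module R m)" "\<And>k. k < m \<Longrightarrow> unit_vec R m k \<in> T"
  shows "carrier (free_module R m) \<subseteq> T"
proof
  interpret cring R by fact
  note F = module_free_module[OF assms(1), of m]
  note T = submoduleD[OF F assms(2)]
  fix x assume x: "x \<in> carrier (free_module R m)"
  have "(\<lambda>i\<in>{..<m}. if i < n then x i else \<zero>) \<in> T" if "n \<le> m" for n
    using that
  proof (induction n)
    case 0
    have "(\<lambda>i\<in>{..<m}. if i < 0 then x i else \<zero>) = \<zero>\<^bsub>free_module R m\<^esub>"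
      unfolding free_module_simps by (rule restrict_ext) simp
    then show ?case using T(2) by (simp only:)
  next
    case (Suc n)
    have ih: "(\<lambda>i\<in>{..<m}. if i < n then x i else \<zero>) \<in> T" by (rule Suc.IH) (use Suc.prems in simp)
    have "x n \<odot>\<^bsub>free_module R m\<^esub> unit_vec R m n \<in> T"
      using Suc x assms(3) by (intro T(4)) (simp_all add: free_module_nth)
    then have "(\<lambda>i\<in>{..<m}. if i < n then x i else \<zero>) \<oplus>\<^bsub>free_module R m\<^esub> (x n \<odot>\<^bsub>free_module R m\<^esub> unit_vec R m n) \<in> T"
      by (rule T(3)[OF ih])
    also have "(\<lambda>i\<in>{..<m}. if i < n then x i else \<zero>) \<oplus>\<^bsub>free_module R m\<^esub> (x n \<odot>\<^bsub>free_module R m\<^esub> unit_vec R m n)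
       = (\<lambda>i\<in>{..<m}. if i < Suc n then x i else \<zero>)"
      using x Suc.prems by (auto simp: free_module_simps unit_vec_def fun_eq_iff PiE_iff less_Suc_eq)
    finally show ?case .
  qed
  from this[of m] have "(\<lambda>i\<in>{..<m}. if i < m then x i else \<zero>) \<in> T" by simp
  also have "(\<lambda>i\<in>{..<m}. if i < m then x i else \<zero>) = x"
    using x by (auto simp: free_module_simps fun_eq_iff PiE_iff extensional_def)
  finally show "x \<in> T" .
qed

lemma surj_from_free:
  assumes N: "module R N" and S: "submodule S R N" and A: "A \<subseteq> S" "finite A"
    and gen: "\<And>T. submodule T R N \<Longrightarrow> A \<subseteq> T \<Longrightarrow> S \<subseteq> T"
  shows "\<exists>m h. h \<in> module_homs R (free_module R m) N \<and> h ` carrier (free_module R m) = S"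
proof -
  interpret N: module R N by fact
  note F = module_free_module[OF N.is_cring]
  obtain g and m :: nat where g: "A = g ` {..<m}"
    using finite_imp_nat_seg_image_inj_on[OF A(2)] by (metis lessThan_def)
  have gc: "g \<in> {..<m} \<rightarrow> carrier N" using g A submoduleD(1)[OF N S] by auto
  let ?h = "lin_comb R N m g"
  note h = lin_comb_hom[OF N gc]
  have "A \<subseteq> ?h ` carrier (free_module R m)"
    using lin_comb_unit_vec[OF N gc] unit_vec_closed[OF N.is_cring, of m]
    unfolding g by (auto simp: image_iff) (metis lessThan_iff)
  with gen[OF submodule_image[OF F N h]] have 1: "S \<subseteq> ?h ` carrier (free_module R m)" by blast
  have "submodule {c \<in> carrier (free_module R m). ?h c \<in> S} R (free_module R m)"
  proof (rule submoduleI'[OF F])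
    show "\<zero>\<^bsub>free_module R m\<^esub> \<in> {c \<in> carrier (free_module R m). ?h c \<in> S}"
      using module_hom_zero[OF F N h] submoduleD(2)[OF N S] F[of m, THEN module.axioms(2)] 
      by (auto intro: abelian_group.axioms abelian_monoid.zero_closed)
  qed (use module_homD[OF h] submoduleD[OF N S] F[of m] in
        \<open>auto simp: module.smult_closed abelian_monoid.a_closed abelian_group.axioms(1) module.axioms(2)\<close>)
  then have "carrier (free_module R m) \<subseteq> {c \<in> carrier (free_module R m). ?h c \<in> S}"
    by (rule free_module_induct[OF N.is_cring])
       (use lin_comb_unit_vec[OF N gc] unit_vec_closed[OF N.is_cring] A g in auto)
  with 1 h show ?thesis by blast
qed

lemma submodule_free_fin_gen:
  fixes R (structure)
  assumes "cring R" "noetherian_ring R" "submodule S R (free_module R n)"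
  shows "\<exists>A\<subseteq>S. finite A \<and> (\<forall>T. submodule T R (free_module R n) \<longrightarrow> A \<subseteq> T \<longrightarrow> S \<subseteq> T)"
  using assms(3)
proof (induction n arbitrary: S)
  case 0
  have "S \<subseteq> {\<zero>\<^bsub>free_module R 0\<^esub>}"
    using submoduleD(1)[OF module_free_module[OF assms(1)] 0] by (auto simp: free_module_simps restrict_def)
  then show ?case
    using submoduleD(2)[OF module_free_module[OF assms(1)]] by (intro exI[of _ "{}"]) blast
next
  case (Suc n)
  interpret cring R by fact
  let ?F = "free_module R (Suc n)" and ?G = "free_module R n"
  note F = module_free_module[OF assms(1), of "Suc n"] and G = module_free_module[OF assms(1), of n]
  interpret F: module R ?F by fact
  interpret G: module R ?G by fact
  note S = submoduleD[OF F Suc.prems]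
  have nth: "(x \<oplus>\<^bsub>?F\<^esub> y) n = x n \<oplus> y n" "(r \<odot>\<^bsub>?F\<^esub> x) n = r \<otimes> x n" "\<zero>\<^bsub>?F\<^esub> n = \<zero>" for x y r
    by (simp_all add: free_module_simps)
  have nc: "x n \<in> carrier R" if "x \<in> carrier ?F" for x using that by (simp add: free_module_nth)
  have idl: "ideal ((\<lambda>x. x n) ` T) R" if "submodule T R ?F" for T
  proof -
    note T = submoduleD[OF F that]
    show ?thesis
    proof (rule idealI[OF ring_axioms])
      have smul: "r \<otimes> x n \<in> (\<lambda>x. x n) ` T" if "r \<in> carrier R" "x \<in> T" for r x
        using T(4)[OF that] nth(2)[of r x] by (metis imageI)
      show "subgroup ((\<lambda>x. x n) ` T) (add_monoid R)"
      proof (rule add.subgroupI, goal_cases)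
        case 1 then show ?case using T(1) nc by auto
      next
        case 2 then show ?case using T(2) by auto
      next
        case (3 a)
        then obtain x where x: "x \<in> T" "a = x n" by auto
        then have "\<ominus> \<one> \<otimes> x n \<in> (\<lambda>x. x n) ` T" by (intro smul) auto
        moreover have "\<ominus> \<one> \<otimes> x n = \<ominus> a" using x T(1) nc by (auto simp: l_minus)
        ultimately show ?case by simp
      next
        case (4 a b)
        then show ?case using T(3) nth(1) by (auto simp: image_iff) metis
      qed
      fix a r assume "a \<in> (\<lambda>x. x n) ` T" "r \<in> carrier R"
      then show "r \<otimes> a \<in> (\<lambda>x. x n) ` T" using smul by auto
      then show "a \<otimes> r \<in> (\<lambda>x. x n) ` T"
        using \<open>a \<in> _\<close> \<open>r \<in> _\<close> T(1) nc by (auto simp: m_comm)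
    qed
  qed
  obtain A where A: "A \<subseteq> carrier R" "finite A" "(\<lambda>x. x n) ` S = Idl A"
    using noetherian_ring.finetely_gen[OF assms(2) idl[OF Suc.prems]] by blast
  have "A \<subseteq> (\<lambda>x. x n) ` S" using A genideal_self by auto
  then obtain B where B: "B \<subseteq> S" "finite B" "A = (\<lambda>x. x n) ` B"
    using A(2) by (meson finite_subset_image)
  define ext where "ext y = (\<lambda>i\<in>{..<Suc n}. if i < n then y i else \<zero>)" for y :: "nat \<Rightarrow> 'a"
  have ext: "ext (x \<oplus>\<^bsub>?G\<^esub> y) = ext x \<oplus>\<^bsub>?F\<^esub> ext y" "r \<in> carrier R \<Longrightarrow> ext (r \<odot>\<^bsub>?G\<^esub> x) = r \<odot>\<^bsub>?F\<^esub> ext x"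
     "ext \<zero>\<^bsub>?G\<^esub> = \<zero>\<^bsub>?F\<^esub>" for x y r
    by (auto simp: ext_def free_module_simps fun_eq_iff)
  have er: "restrict u {..<n} \<in> carrier ?G" "ext (restrict u {..<n}) = u"
    if u: "u \<in> carrier ?F" and un: "u n = \<zero>" for u
  proof -
    show *: "restrict u {..<n} \<in> carrier ?G"
      using free_module_nth[OF u] by (simp add: free_module_simps)
    show "ext (restrict u {..<n}) = u"
      using free_module_nth[OF u] un
      by (intro free_module_eqI[OF _ u]) (auto simp: ext_def free_module_simps less_Suc_eq)
  qed
  have sub: "submodule {y \<in> carrier ?G. ext y \<in> T} R ?G" if "submodule T R ?F" for T
    using submoduleD[OF F that] by (intro submoduleI'[OF G]) (auto simp: ext)
  obtain C where C: "C \<subseteq> {y \<in> carrier ?G. ext y \<in> S}" "finite C"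
    "\<And>T. submodule T R ?G \<Longrightarrow> C \<subseteq> T \<Longrightarrow> {y \<in> carrier ?G. ext y \<in> S} \<subseteq> T"
    using Suc.IH[OF sub[OF Suc.prems]] by blast
  show ?case
  proof (intro exI[of _ "B \<union> ext ` C"] conjI allI impI)
    show "B \<union> ext ` C \<subseteq> S" "finite (B \<union> ext ` C)" using B C by auto
    fix T assume T: "submodule T R ?F" and BT: "B \<union> ext ` C \<subseteq> T"
    note T' = submoduleD[OF F T]
    have TS: "submodule (T \<inter> S) R ?F" by (rule submoduleI'[OF F]) (use S T' in auto)
    have "A \<subseteq> (\<lambda>x. x n) ` (T \<inter> S)" using B BT by auto
    then have J: "(\<lambda>x. x n) ` S \<subseteq> (\<lambda>x. x n) ` (T \<inter> S)"
      using genideal_minimal[OF idl[OF TS]] A by auto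
    show "S \<subseteq> T"
    proof
      fix x assume x: "x \<in> S"
      then obtain t where t: "t \<in> T" "t \<in> S" "x n = t n" using J by blast
      have tc: "t \<in> carrier ?F" "x \<in> carrier ?F" using t x S by auto
      let ?u = "x \<oplus>\<^bsub>?F\<^esub> ((\<ominus> \<one>) \<odot>\<^bsub>?F\<^esub> t)"
      have u: "?u \<in> S" using x t S by auto
      have un: "?u n = \<zero>" using t nc[OF tc(1)] by (simp add: nth l_minus r_neg)
      have uc: "?u \<in> carrier ?F" using u S by auto
      let ?y = "restrict ?u {..<n}"
      have y: "?y \<in> carrier ?G" by (rule er(1)[OF uc un])
      have ey: "ext ?y = ?u" by (rule er(2)[OF uc un])
      have "?y \<in> {y \<in> carrier ?G. ext y \<in> T}"
      proof -
        have "C \<subseteq> {y \<in> carrier ?G. ext y \<in> T}" using C(1) BT by blast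
        then have "{y \<in> carrier ?G. ext y \<in> S} \<subseteq> {y \<in> carrier ?G. ext y \<in> T}"
          by (rule C(3)[OF sub[OF T]])
        moreover have "?y \<in> {y \<in> carrier ?G. ext y \<in> S}" using y ey u by simp
        ultimately show ?thesis by (rule subsetD)
      qed
      then have "?u \<in> T" using ey by simp
      then have "?u \<oplus>\<^bsub>?F\<^esub> t \<in> T" using t T' by auto
      moreover have "?u \<oplus>\<^bsub>?F\<^esub> t = x"
        using tc by (simp add: F.smult_l_minus F.M.a_assoc F.M.l_neg)
      ultimately show "x \<in> T" by simp
    qed
  qed
qed

lemma surj_onto_kernel:
  assumes "cring R" "noetherian_ring R" "module R N" "h \<in> module_homs R (free_module R n) N"
  shows "\<exists>m d. d \<in> module_homs R (free_module R m) (free_module R n) \<and>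
    d ` carrier (free_module R m) = a_kernel (free_module R n) N h"
proof -
  note F = module_free_module[OF assms(1)]
  have K: "submodule (a_kernel (free_module R n) N h) R (free_module R n)"
    by (rule submodule_kernel[OF F assms(3,4)])
  show ?thesis
    using submodule_free_fin_gen[OF assms(1,2) K] surj_from_free[OF F K] by blast
qed

lemma free_resolution_exists:
  assumes "cring R" "noetherian_ring R" "module R N" "fin_gen_module R N"
  shows "\<exists>P. free_resolution R N P"
proof -
  note F = module_free_module[OF assms(1)]
  obtain A where A: "A \<subseteq> carrier N" "finite A" "\<And>T. submodule T R N \<Longrightarrow> A \<subseteq> T \<Longrightarrow> T = carrier N"
    using assms(4) unfolding fin_gen_module_def by blast
  obtain m e where e: "e \<in> module_homs R (free_module R m) N" "e ` carrier (free_module R m) = carrier N"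
    using surj_from_free[OF assms(3) module.carrier_is_submodule[OF assms(3)] A(1,2)] A(3) by blast
  obtain m' d where d: "d \<in> module_homs R (free_module R m') (free_module R m)"
    "d ` carrier (free_module R m') = a_kernel (free_module R m) N e"
    using surj_onto_kernel[OF assms(1-3) e(1)] by blast
  have "\<exists>s. \<forall>k::nat. (case s k of (a, b, f) \<Rightarrow> f \<in> module_homs R (free_module R b) (free_module R a) \<and>
        (k = 0 \<longrightarrow> a = m \<and> f ` carrier (free_module R b) = a_kernel (free_module R m) N e)) \<and>
     (case s k of (a, b, f) \<Rightarrow> case s (Suc k) of (a', b', f') \<Rightarrow>
        a' = b \<and> f' ` carrier (free_module R b') = a_kernel (free_module R b) (free_module R a) f)"
  proof (rule dependent_nat_choice, goal_cases)
    case 1 then show ?case using d by auto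
  next
    case (2 x k)
    obtain a b f where x: "x = (a, b, f)" by (cases x)
    then have "f \<in> module_homs R (free_module R b) (free_module R a)" using 2 by auto
    from surj_onto_kernel[OF assms(1,2) F this] obtain b' f' where
      "f' \<in> module_homs R (free_module R b') (free_module R b)"
      "f' ` carrier (free_module R b') = a_kernel (free_module R b) (free_module R a) f" by blast
    then show ?case by (intro exI[of _ "(b, b', f')"]) (simp add: x)
  qed
  then obtain s where s': "\<forall>k::nat. (case s k of (a, b, f) \<Rightarrow> f \<in> module_homs R (free_module R b) (free_module R a) \<and>
        (k = 0 \<longrightarrow> a = m \<and> f ` carrier (free_module R b) = a_kernel (free_module R m) N e)) \<and>
     (case s k of (a, b, f) \<Rightarrow> case s (Suc k) of (a', b', f') \<Rightarrow>
        a' = b \<and> f' ` carrier (free_module R b') = a_kernel (free_module R b) (free_module R a) f)"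
    by (rule exE)
  note s = s'[rule_format, THEN conjunct1] s'[rule_format, THEN conjunct2]
  let ?P = "\<lparr>rank = (\<lambda>k. fst (s k)), diff = (\<lambda>k. snd (snd (s k))), aug = e\<rparr>"
  have r: "fst (snd (s k)) = fst (s (Suc k))" for k using s(2)[of k] by (auto split: prod.splits)
  have 1: "diff ?P k \<in> module_homs R (res_module R ?P (Suc k)) (res_module R ?P k)" for k
    using s(1)[of k] r[of k] by (auto split: prod.splits)
  have 2: "rank ?P 0 = m" "diff ?P 0 ` carrier (res_module R ?P 1) = a_kernel (free_module R m) N e"
    using s(1)[of 0] r[of 0] by (auto split: prod.splits)
  have 3: "diff ?P (Suc k) ` carrier (res_module R ?P (Suc (Suc k))) =
       a_kernel (res_module R ?P (Suc k)) (res_module R ?P k) (diff ?P k)" for k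
    using s(2)[of k] unfolding case_prod_unfold r by simp
  have 4: "aug ?P = e" by simp
  have "free_resolution R N ?P"
    unfolding free_resolution_def 4 2 using 1 3 e by blast
  then show ?thesis by blast
qed


lemma lift_from_free:
  assumes X: "module R X" and Y: "module R Y"
    and f: "f \<in> module_homs R (free_module R m) Y" and p: "p \<in> module_homs R X Y"
    and sub: "f ` carrier (free_module R m) \<subseteq> p ` carrier X"
  shows "\<exists>g \<in> module_homs R (free_module R m) X. \<forall>x\<in>carrier (free_module R m). p (g x) = f x"
proof -
  interpret X: module R X by fact
  interpret Y: module R Y by fact
  note F = module_free_module[OF X.is_cring, of m]
  interpret F: module R "free_module R m" by (rule F)
  note e = unit_vec_closed[OF X.is_cring, of m]
  have "f (unit_vec R m k) \<in> p ` carrier X" for k using sub e by blast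
  then have "\<forall>k. \<exists>x\<in>carrier X. p x = f (unit_vec R m k)" by (metis imageE)
  then obtain c where c: "\<And>k. c k \<in> carrier X" "\<And>k. p (c k) = f (unit_vec R m k)" by metis
  let ?g = "lin_comb R X m c"
  have cc: "c \<in> {..<m} \<rightarrow> carrier X" using c by auto
  note g = lin_comb_hom[OF X cc]
  note G = module_homD[OF g] and P = module_homD[OF p] and Fh = module_homD[OF f]
  have "submodule {x \<in> carrier (free_module R m). p (?g x) = f x} R (free_module R m)"
    by (rule submoduleI'[OF F])
       (auto simp: G P Fh module_hom_zero[OF F X g] module_hom_zero[OF F Y f] module_hom_zero[OF X Y p])
  then have "carrier (free_module R m) \<subseteq> {x \<in> carrier (free_module R m). p (?g x) = f x}"
    by (rule free_module_induct[OF X.is_cring]) (use lin_comb_unit_vec[OF X cc] c e in auto)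
  with g show ?thesis by blast
qed

lemma module_homs_comp:
  assumes "module R L" "f \<in> module_homs R L M" "g \<in> module_homs R M N"
  shows "(\<lambda>x\<in>carrier L. g (f x)) \<in> module_homs R L N"
proof -
  interpret module R L by fact
  show ?thesis by (rule module_homI) (auto simp: module_homD[OF assms(2)] module_homD[OF assms(3)])
qed

lemma chain_lift_exists:
  assumes N': "module R N'" and N: "module R N" and h: "h \<in> module_homs R N' N"
    and P': "free_resolution R N' P'" and P: "free_resolution R N P"
  shows "\<exists>\<phi>. chain_lift R P' P h \<phi>"
proof -
  have R: "cring R" using N by (rule module.axioms(1))
  note F = module_free_module[OF R]
  have P1: "aug P \<in> module_homs R (res_module R P 0) N"
    "\<And>k. diff P k \<in> module_homs R (res_module R P (Suc k)) (res_module R P k)"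
    "aug P ` carrier (res_module R P 0) = carrier N"
    "diff P 0 ` carrier (res_module R P (Suc 0)) = a_kernel (res_module R P 0) N (aug P)"
    "\<And>k. diff P (Suc k) ` carrier (res_module R P (Suc (Suc k))) =
       a_kernel (res_module R P (Suc k)) (res_module R P k) (diff P k)"
    using P by (simp_all add: free_resolution_def)
  have P2: "aug P' \<in> module_homs R (res_module R P' 0) N'"
    "\<And>k. diff P' k \<in> module_homs R (res_module R P' (Suc k)) (res_module R P' k)"
    "diff P' 0 ` carrier (res_module R P' (Suc 0)) = a_kernel (res_module R P' 0) N' (aug P')"
    "\<And>k. diff P' (Suc k) ` carrier (res_module R P' (Suc (Suc k))) =
       a_kernel (res_module R P' (Suc k)) (res_module R P' k) (diff P' k)"
    using P' by (simp_all add: free_resolution_def)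
  have dd0: "aug P' (diff P' 0 x) = \<zero>\<^bsub>N'\<^esub>" if "x \<in> carrier (res_module R P' (Suc 0))" for x
    using P2(3) that by (auto simp: a_kernel_def kernel_def)
  have dd: "diff P' k (diff P' (Suc k) x) = \<zero>\<^bsub>res_module R P' k\<^esub>"
    if "x \<in> carrier (res_module R P' (Suc (Suc k)))" for x k
    using P2(4)[of k] that by (auto simp: a_kernel_def kernel_def)
  let ?ok = "\<lambda>k f. f \<in> module_homs R (res_module R P' k) (res_module R P k)"
  let ?sq = "\<lambda>k f g. \<forall>x\<in>carrier (res_module R P' (Suc k)). diff P k (g x) = f (diff P' k x)"
  have "\<exists>\<phi>. \<forall>k. (?ok k (\<phi> k) \<and> (k = 0 \<longrightarrow>
        (\<forall>x\<in>carrier (res_module R P' 0). aug P (\<phi> k x) = h (aug P' x))) \<and>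
        (\<forall>j. k = Suc j \<longrightarrow> (\<forall>x\<in>carrier (res_module R P' (Suc j)). diff P' j x = \<zero>\<^bsub>res_module R P' j\<^esub>
          \<longrightarrow> diff P j (\<phi> k x) = \<zero>\<^bsub>res_module R P j\<^esub>))) \<and> ?sq k (\<phi> k) (\<phi> (Suc k))"
  proof (rule dependent_nat_choice, goal_cases)
    case 1
    have "(\<lambda>x\<in>carrier (res_module R P' 0). h (aug P' x)) \<in> module_homs R (res_module R P' 0) N"
      by (rule module_homs_comp[OF F P2(1) h])
    from lift_from_free[OF F N this P1(1)] show ?case
      using P1(3) module_homD(1)[OF P2(1)] module_homD(1)[OF h] by (auto simp: image_subset_iff)
  next
    case (2 f k)
    note f = module_homD[OF conjunct1[OF 2]]
    let ?f = "\<lambda>x\<in>carrier (res_module R P' (Suc k)). f (diff P' k x)"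
    have c: "?f \<in> module_homs R (res_module R P' (Suc k)) (res_module R P k)"
      by (rule module_homs_comp[OF F P2(2) conjunct1[OF 2]])
    have "f (diff P' k x) \<in> diff P k ` carrier (res_module R P (Suc k))"
      if x: "x \<in> carrier (res_module R P' (Suc k))" for x
    proof (cases k)
      case 0
      then show ?thesis
        using 2 x P1(4) dd0 module_homD(1)[OF P2(2)] f(1) module_hom_zero[OF N' N h]
        by (auto simp: a_kernel_def kernel_def)
    next
      case (Suc j)
      then show ?thesis
        using 2 x P1(5)[of j] dd[of x j] module_homD(1)[OF P2(2), of x "Suc j"] f(1)
        by (auto simp: a_kernel_def kernel_def)
    qed
    then obtain g where g: "?ok (Suc k) g"
      "\<And>x. x \<in> carrier (res_module R P' (Suc k)) \<Longrightarrow> diff P k (g x) = f (diff P' k x)"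
      using lift_from_free[OF F F c P1(2)] by (force simp: image_subset_iff)
    have "f \<zero>\<^bsub>res_module R P' k\<^esub> = \<zero>\<^bsub>res_module R P k\<^esub>"
      by (rule module_hom_zero[OF F F conjunct1[OF 2]])
    with g show ?case by (intro exI[of _ g]) auto
  qed
  then obtain \<phi> where phi: "\<forall>k. (?ok k (\<phi> k) \<and> (k = 0 \<longrightarrow>
        (\<forall>x\<in>carrier (res_module R P' 0). aug P (\<phi> k x) = h (aug P' x))) \<and>
        (\<forall>j. k = Suc j \<longrightarrow> (\<forall>x\<in>carrier (res_module R P' (Suc j)). diff P' j x = \<zero>\<^bsub>res_module R P' j\<^esub>
          \<longrightarrow> diff P j (\<phi> k x) = \<zero>\<^bsub>res_module R P j\<^esub>))) \<and> ?sq k (\<phi> k) (\<phi> (Suc k))"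
    by (rule exE)
  then have "chain_lift R P' P h \<phi>" unfolding chain_lift_def by blast
  then show ?thesis by blast
qed

lemma module_quotient_module:
  assumes M: "module R M" and N: "submodule N R M"
  shows "module R (quotient_module M N)"
    and "(\<lambda>x\<in>carrier M. N +>\<^bsub>M\<^esub> x) \<in> module_homs R M (quotient_module M N)"
    and "(\<lambda>x\<in>carrier M. N +>\<^bsub>M\<^esub> x) ` carrier M = carrier (quotient_module M N)"
    and "\<And>r x. r \<in> carrier R \<Longrightarrow> x \<in> carrier M \<Longrightarrow> r \<odot>\<^bsub>quotient_module M N\<^esub> (N +>\<^bsub>M\<^esub> x) = N +>\<^bsub>M\<^esub> (r \<odot>\<^bsub>M\<^esub> x)"
proof -
  interpret M: module R M by fact
  note N' = submoduleD[OF M N]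
  interpret A: abelian_subgroup N M
    by (rule abelian_subgroupI3[OF _ M.M.abelian_group_axioms])
       (rule additive_subgroup.intro[OF submodule.axioms(1)[OF N]])
  let ?Q = "quotient_module M N"
  have car: "carrier ?Q = (\<lambda>x. N +>\<^bsub>M\<^esub> x) ` carrier M"
    by (auto simp: quotient_module_def A_RCOSETS_def')
  have add: "(N +>\<^bsub>M\<^esub> x) \<oplus>\<^bsub>?Q\<^esub> (N +>\<^bsub>M\<^esub> y) = N +>\<^bsub>M\<^esub> (x \<oplus>\<^bsub>M\<^esub> y)"
    if "x \<in> carrier M" "y \<in> carrier M" for x y
    using that by (simp add: quotient_module_def A.a_rcos_sum)
  have zero: "\<zero>\<^bsub>?Q\<^esub> = N +>\<^bsub>M\<^esub> \<zero>\<^bsub>M\<^esub>"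
    by (simp add: quotient_module_def A.a_rcos_const[OF A.zero_closed])
  have sm: "r \<odot>\<^bsub>?Q\<^esub> (N +>\<^bsub>M\<^esub> x) = N +>\<^bsub>M\<^esub> (r \<odot>\<^bsub>M\<^esub> x)" if r: "r \<in> carrier R" and x: "x \<in> carrier M" for r x
  proof -
    have "N +>\<^bsub>M\<^esub> (r \<odot>\<^bsub>M\<^esub> y) = N +>\<^bsub>M\<^esub> (r \<odot>\<^bsub>M\<^esub> x)" if y: "y \<in> N +>\<^bsub>M\<^esub> x" for y
    proof -
      obtain n where n: "n \<in> N" "y = n \<oplus>\<^bsub>M\<^esub> x" using y by (auto simp: a_r_coset_def')
      then have "r \<odot>\<^bsub>M\<^esub> y = r \<odot>\<^bsub>M\<^esub> n \<oplus>\<^bsub>M\<^esub> r \<odot>\<^bsub>M\<^esub> x"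
        using r x N'(1) M.smult_r_distr by blast
      then have "r \<odot>\<^bsub>M\<^esub> y \<in> N +>\<^bsub>M\<^esub> (r \<odot>\<^bsub>M\<^esub> x)"
        using N'(4)[OF r n(1)] by (auto simp: a_r_coset_def')
      then show ?thesis
        using A.a_repr_independence'[of "r \<odot>\<^bsub>M\<^esub> y" "r \<odot>\<^bsub>M\<^esub> x"] r x by simp
    qed
    moreover have "x \<in> N +>\<^bsub>M\<^esub> x" using A.a_rcos_self[OF x] .
    ultimately have "(\<Union>y\<in>N +>\<^bsub>M\<^esub> x. N +>\<^bsub>M\<^esub> (r \<odot>\<^bsub>M\<^esub> y)) = N +>\<^bsub>M\<^esub> (r \<odot>\<^bsub>M\<^esub> x)" by blast
    then show ?thesis by (simp add: quotient_module_def)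
  qed
  show "\<And>r x. r \<in> carrier R \<Longrightarrow> x \<in> carrier M \<Longrightarrow> r \<odot>\<^bsub>?Q\<^esub> (N +>\<^bsub>M\<^esub> x) = N +>\<^bsub>M\<^esub> (r \<odot>\<^bsub>M\<^esub> x)"
    by (rule sm)
  have "abelian_group ?Q"
  proof (rule abelian_groupI)
    fix X assume "X \<in> carrier ?Q"
    then obtain x where x: "x \<in> carrier M" "X = N +>\<^bsub>M\<^esub> x" by (auto simp: car)
    have "(N +>\<^bsub>M\<^esub> (\<ominus>\<^bsub>M\<^esub> x)) \<oplus>\<^bsub>?Q\<^esub> X = \<zero>\<^bsub>?Q\<^esub>" using x by (simp add: add zero M.M.l_neg)
    then show "\<exists>Y\<in>carrier ?Q. Y \<oplus>\<^bsub>?Q\<^esub> X = \<zero>\<^bsub>?Q\<^esub>" using x by (auto simp: car)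
  qed (auto simp: car zero add M.M.a_ac)
  then show "module R ?Q"
    by (intro moduleI M.is_cring)
       (auto simp: car sm add M.smult_l_distr M.smult_r_distr M.smult_assoc1)
  show "(\<lambda>x\<in>carrier M. N +>\<^bsub>M\<^esub> x) \<in> module_homs R M ?Q"
    by (rule module_homI) (auto simp: car add sm)
  show "(\<lambda>x\<in>carrier M. N +>\<^bsub>M\<^esub> x) ` carrier M = carrier ?Q" by (simp add: car)
qed

lemma fin_gen_self_module:
  assumes "cring R" shows "fin_gen_module R (self_module R)"
proof -
  interpret cring R by fact
  have "T = carrier R" if T: "submodule T R (self_module R)" and 1: "\<one>\<^bsub>R\<^esub> \<in> T" for T
  proof
    note T' = submoduleD[OF module_self_module[OF assms] T]
    show "T \<subseteq> carrier R" using T'(1) by (simp add: self_module_def)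
    show "carrier R \<subseteq> T"
      using T'(4)[OF _ 1] by (auto simp: self_module_def)
  qed
  then show ?thesis
    unfolding fin_gen_module_def by (intro exI[of _ "{\<one>\<^bsub>R\<^esub>}"]) (auto simp: self_module_def)
qed

lemma fin_gen_quotient_module:
  assumes M: "module R M" and N: "submodule N R M" and fg: "fin_gen_module R M"
  shows "fin_gen_module R (quotient_module M N)"
proof -
  note q = module_quotient_module[OF M N]
  interpret M: module R M by fact
  let ?q = "\<lambda>x\<in>carrier M. N +>\<^bsub>M\<^esub> x"
  obtain A where A: "A \<subseteq> carrier M" "finite A" "\<And>T. submodule T R M \<Longrightarrow> A \<subseteq> T \<Longrightarrow> T = carrier M"
    using fg unfolding fin_gen_module_def by blast
  have "T = carrier (quotient_module M N)"
    if T: "submodule T R (quotient_module M N)" and AT: "?q ` A \<subseteq> T" for T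
  proof -
    note T' = submoduleD[OF q(1) T]
    have "submodule {x \<in> carrier M. ?q x \<in> T} R M"
    proof (rule submoduleI'[OF M], goal_cases)
      case 2 show ?case using module_hom_zero[OF M q(1,2)] T'(2) M.M.zero_closed by simp
    next
      case (3 x y)
      then show ?case using module_homD(2)[OF q(2), of x y] T'(3)[of "?q x" "?q y"] by auto
    next
      case (4 r x)
      then show ?case using module_homD(3)[OF q(2), of r x] T'(4)[of r "?q x"] by auto
    qed blast
    then have "{x \<in> carrier M. ?q x \<in> T} = carrier M"
      by (rule A(3)) (use A(1) AT in blast)
    then have "?q ` carrier M \<subseteq> T" by blast
    with q(3) T'(1) show ?thesis by blast
  qed
  then show ?thesis
    unfolding fin_gen_module_def
    by (intro exI[of _ "?q ` A"] conjI allI impI) (use A q(3) in auto)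
qed

lemma submodule_ideal:
  assumes "cring R" "ideal I R" shows "submodule I R (self_module R)"
proof -
  interpret cring R by fact
  interpret ideal I R by fact
  show ?thesis
    by (rule submoduleI'[OF module_self_module[OF assms(1)]])
       (auto simp: self_module_def a_subset[THEN subsetD] I_l_closed)
qed

lemma ideal_power:
  assumes "cring R" "ideal \<aa> R" shows "ideal (\<aa> [^]\<^bsub>ideals_set R\<^esub> (n::nat)) R"
  using monoid.nat_pow_closed[OF comm_monoid.axioms(1)[OF cring.ideals_set_is_comm_monoid[OF assms(1)]], of \<aa> n]
  using assms(2) by (simp add: ideals_set_def)

lemma power_quotient_module:
  assumes "cring R" "ideal \<aa> R"
  shows "module R (power_quotient R \<aa> n)" "fin_gen_module R (power_quotient R \<aa> n)"
  unfolding power_quotient_def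
  by (intro module_quotient_module fin_gen_quotient_module module_self_module fin_gen_self_module
      submodule_ideal ideal_power assms)+

lemma power_proj_hom:
  fixes R (structure)
  assumes R: "cring R" and a: "ideal \<aa> R"
  shows "power_proj R \<aa> n \<in> module_homs R (power_quotient R \<aa> (Suc n)) (power_quotient R \<aa> n)"
    and "x \<in> carrier R \<Longrightarrow> power_proj R \<aa> n ((\<aa> [^]\<^bsub>ideals_set R\<^esub> (Suc n)) +>\<^bsub>R\<^esub> x) = (\<aa> [^]\<^bsub>ideals_set R\<^esub> n) +>\<^bsub>R\<^esub> x"
proof -
  interpret cring R by fact
  let ?I = "\<aa> [^]\<^bsub>ideals_set R\<^esub> (Suc n)" and ?J = "\<aa> [^]\<^bsub>ideals_set R\<^esub> n"
  interpret I: ideal ?I R by (rule ideal_power[OF R a])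
  interpret J: ideal ?J R by (rule ideal_power[OF R a])
  have "?I = ideal_prod R ?J \<aa>" by (simp add: nat_pow_def ideals_set_def)
  then have IJ: "?I \<subseteq> ?J" using ideal_prod_inter[OF ideal_power[OF R a, of n] a] by auto
  note S = module_self_module[OF R]
  note q = module_quotient_module[OF S submodule_ideal[OF R ideal_power[OF R a]]]
  have co: "K +>\<^bsub>self_module R\<^esub> x = K +>\<^bsub>R\<^esub> x" for K x
    by (simp add: a_r_coset_def' self_module_def)
  have carS: "carrier (self_module R) = carrier R" by (simp add: self_module_def)
  have car: "carrier (power_quotient R \<aa> k) = (\<lambda>x. (\<aa> [^]\<^bsub>ideals_set R\<^esub> k) +>\<^bsub>R\<^esub> x) ` carrier R" for k
    using q(3)[of k] by (simp add: power_quotient_def co carS)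
  have eq: "power_proj R \<aa> n (?I +>\<^bsub>R\<^esub> x) = ?J +>\<^bsub>R\<^esub> x" if x: "x \<in> carrier R" for x
  proof -
    have "?J +>\<^bsub>R\<^esub> y = ?J +>\<^bsub>R\<^esub> x" if "y \<in> ?I +>\<^bsub>R\<^esub> x" for y
      using that IJ x by (intro J.a_repr_independence'[symmetric]) (auto simp: a_r_coset_def')
    moreover have "x \<in> ?I +>\<^bsub>R\<^esub> x" using I.a_rcos_self[OF x] .
    ultimately have "(\<Union>y\<in>?I +>\<^bsub>R\<^esub> x. ?J +>\<^bsub>R\<^esub> y) = ?J +>\<^bsub>R\<^esub> x" by blast
    moreover have "?I +>\<^bsub>R\<^esub> x \<in> carrier (power_quotient R \<aa> (Suc n))" unfolding car using x by (rule imageI)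
    ultimately show ?thesis unfolding power_proj_def by (simp only: restrict_apply if_True)
  qed
  show "x \<in> carrier R \<Longrightarrow> power_proj R \<aa> n (?I +>\<^bsub>R\<^esub> x) = ?J +>\<^bsub>R\<^esub> x" by (rule eq)
  have h2: "(K k +>\<^bsub>R\<^esub> x) \<oplus>\<^bsub>power_quotient R \<aa> k\<^esub> (K k +>\<^bsub>R\<^esub> y) = K k +>\<^bsub>R\<^esub> (x \<oplus> y)"
    "(r \<odot>\<^bsub>power_quotient R \<aa> k\<^esub> (K k +>\<^bsub>R\<^esub> x)) = K k +>\<^bsub>R\<^esub> (r \<otimes> x)"
    if "x \<in> carrier R" "y \<in> carrier R" "r \<in> carrier R" "K = (\<lambda>k. \<aa> [^]\<^bsub>ideals_set R\<^esub> k)" for x y r k K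
    using module_homD(2)[OF q(2)[of k], of x y] q(4)[of r x k] that
    by (simp_all add: power_quotient_def co carS) (simp_all add: self_module_def)
  note h = h2[OF _ _ _ refl]
  show "power_proj R \<aa> n \<in> module_homs R (power_quotient R \<aa> (Suc n)) (power_quotient R \<aa> n)"
  proof (rule module_homI)
    have "power_proj R \<aa> n X \<in> carrier (power_quotient R \<aa> n)" if X: "X \<in> carrier (power_quotient R \<aa> (Suc n))" for X
    proof -
      obtain x where "x \<in> carrier R" "X = ?I +>\<^bsub>R\<^esub> x" using X unfolding car by blast
      then show ?thesis using eq unfolding car by blast
    qed
    then show "power_proj R \<aa> n \<in> carrier (power_quotient R \<aa> (Suc n)) \<rightarrow>\<^sub>E carrier (power_quotient R \<aa> n)"
      by (auto simp: PiE_iff power_proj_def)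
  next
    fix X Y assume "X \<in> carrier (power_quotient R \<aa> (Suc n))" "Y \<in> carrier (power_quotient R \<aa> (Suc n))"
    then obtain x y where xy: "x \<in> carrier R" "X = ?I +>\<^bsub>R\<^esub> x" "y \<in> carrier R" "Y = ?I +>\<^bsub>R\<^esub> y"
      unfolding car by blast
    show "power_proj R \<aa> n (X \<oplus>\<^bsub>power_quotient R \<aa> (Suc n)\<^esub> Y) =
      power_proj R \<aa> n X \<oplus>\<^bsub>power_quotient R \<aa> n\<^esub> power_proj R \<aa> n Y"
      unfolding xy h(1)[OF xy(1,3) zero_closed] eq[OF xy(1)] eq[OF xy(3)]
      by (rule eq) (simp add: xy)
  next
    fix r X assume r: "r \<in> carrier R" and "X \<in> carrier (power_quotient R \<aa> (Suc n))"
    then obtain x where x: "x \<in> carrier R" "X = ?I +>\<^bsub>R\<^esub> x" unfolding car by blast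
    show "power_proj R \<aa> n (r \<odot>\<^bsub>power_quotient R \<aa> (Suc n)\<^esub> X) =
      r \<odot>\<^bsub>power_quotient R \<aa> n\<^esub> power_proj R \<aa> n X"
      unfolding x h(2)[OF x(1) zero_closed r] eq[OF x(1)]
      by (rule eq) (simp add: x r)
  qed
qed

lemma the_resolution_power_quotient:
  assumes "cring R" "noetherian_ring R" "ideal \<aa> R"
  shows "free_resolution R (power_quotient R \<aa> n) (the_resolution R (power_quotient R \<aa> n))"
  unfolding the_resolution_def
  by (rule someI_ex[OF free_resolution_exists[OF assms(1,2) power_quotient_module[OF assms(1,3)]]])

lemma the_lift_power_proj:
  assumes "cring R" "noetherian_ring R" "ideal \<aa> R"
  defines "P \<equiv> \<lambda>n. the_resolution R (power_quotient R \<aa> n)"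
  shows "chain_lift R (P (Suc n)) (P n) (power_proj R \<aa> n)
    (the_lift R (P (Suc n)) (P n) (power_proj R \<aa> n))"
  unfolding the_lift_def P_def
  by (rule someI_ex[OF chain_lift_exists[OF power_quotient_module(1)[OF assms(1,3)]
        power_quotient_module(1)[OF assms(1,3)] power_proj_hom(1)[OF assms(1,3)]
        the_resolution_power_quotient[OF assms(1-3)] the_resolution_power_quotient[OF assms(1-3)]]])

end

theory Submission
  imports Defs
begin

text \<open>Call \<open>a\<close> a cyclic scalar if \<open>a M \<subseteq> R x\<close> for some \<open>x\<close>. Since \<open>M\<close> is faithful, such an \<open>a\<close>
  yields maps \<open>f : M \<rightarrow> R\<close> and \<open>g : R \<rightarrow> M\<close> whose composites in both orders are multiplication by
  \<open>a\<^sup>2\<close>, so \<open>a\<^sup>2\<close> annihilates \<open>H\<^sup>i\<^sub>\<aa>(M)\<close> whenever \<open>H\<^sup>i\<^sub>\<aa>(R) = 0\<close>, and conversely. A multiplication module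
  over a Noetherian ring is finitely generated, and Nakayama's argument shows that the squares of
  the cyclic scalars generate the unit ideal. Hence \<open>H\<^sup>i\<^sub>\<aa>(M)\<close> and \<open>H\<^sup>i\<^sub>\<aa>(R)\<close> vanish for the same \<open>i\<close>.\<close>

section \<open>Ideals of Noetherian rings\<close>

text \<open>Negation is scaling by \<open>\<ominus> \<one>\<close>, and commutativity turns the left
  condition into a two-sided one.\<close>

lemma (in cring) idealI_cring:
  assumes "I \<subseteq> carrier R" "\<zero> \<in> I" "\<And>x y. x \<in> I \<Longrightarrow> y \<in> I \<Longrightarrow> x \<oplus> y \<in> I"
    and "\<And>r x. r \<in> carrier R \<Longrightarrow> x \<in> I \<Longrightarrow> r \<otimes> x \<in> I"
  shows "ideal I R"
proof (rule idealI[OF ring_axioms])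
  have "\<ominus> x \<in> I" if "x \<in> I" for x
    using assms(4)[of "\<ominus> \<one>" x] that assms(1) by (auto simp: l_minus)
  then show "subgroup I (add_monoid R)"
    using assms(1-3) by (intro add.subgroupI) (auto simp: a_inv_def)
  show "x \<otimes> a \<in> I" "a \<otimes> x \<in> I" if "a \<in> I" "x \<in> carrier R" for a x
    using assms(1) assms(4)[of x a] that by (auto simp: m_comm subset_iff)
qed

text \<open>Zorn's lemma on the proper ideals containing \<open>I\<close>: in a Noetherian ring a
  nonempty chain of ideals contains its union, so the union is again proper.\<close>

lemma (in noetherian_ring) exists_maximalideal:
  assumes "ideal I R" "I \<noteq> carrier R"
  obtains P where "maximalideal P R" "I \<subseteq> P"
proof -
  let ?A = "{J. ideal J R \<and> J \<noteq> carrier R \<and> I \<subseteq> J}"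
  have "\<exists>P\<in>?A. \<forall>J\<in>?A. P \<subseteq> J \<longrightarrow> J = P"
  proof (rule subset_Zorn_nonempty)
    show "?A \<noteq> {}" using assms by blast
    fix C assume C: "C \<noteq> {}" "subset.chain ?A C"
    then have "subset.chain {J. ideal J R} C" by (auto simp: subset_chain_def)
    then have "\<Union>C \<in> C" by (rule ideal_chain_is_trivial[OF C(1)])
    with C(2) show "\<Union>C \<in> ?A" unfolding subset_chain_def by blast
  qed
  then obtain P where P: "P \<in> ?A" "\<forall>J\<in>?A. P \<subseteq> J \<longrightarrow> J = P" by (rule bexE)
  have "maximalideal P R"
  proof (rule maximalidealI)
    show "ideal P R" "carrier R \<noteq> P" using P(1) by auto
    show "J = P \<or> J = carrier R" if "ideal J R" "P \<subseteq> J" for J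
      using P(1) bspec[OF P(2), of J] that by blast
  qed
  with P show thesis using that[of P] by blast
qed


section \<open>Faithful multiplication modules\<close>

text \<open>This is the colon ideal (R x : M), in other words the annihilator of M / R x.\<close>

definition cyclic_scalars :: "('a, 'c) ring_scheme \<Rightarrow> ('a, 'b, 'd) module_scheme \<Rightarrow> 'b \<Rightarrow> 'a set"
  where "cyclic_scalars R M x =
    {a \<in> carrier R. \<forall>m\<in>carrier M. \<exists>r\<in>carrier R. a \<odot>\<^bsub>M\<^esub> m = r \<odot>\<^bsub>M\<^esub> x}"

lemma (in module) submodule_cyclic:
  assumes "x \<in> carrier M"
  shows "submodule {r \<odot>\<^bsub>M\<^esub> x |r. r \<in> carrier R} R M"
proof (rule submoduleI'[OF module_axioms], goal_cases)
  case 2 show ?case using assms by (intro CollectI exI[of _ "\<zero>"]) auto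
next
  case (3 y z)
  then obtain r s where "y = r \<odot>\<^bsub>M\<^esub> x" "z = s \<odot>\<^bsub>M\<^esub> x" "r \<in> carrier R" "s \<in> carrier R" by blast
  then show ?case using assms by (intro CollectI exI[of _ "r \<oplus> s"]) (auto simp: smult_l_distr)
next
  case (4 s y)
  then obtain r where "y = r \<odot>\<^bsub>M\<^esub> x" "r \<in> carrier R" by blast
  then show ?case using assms 4 by (intro CollectI exI[of _ "s \<otimes> r"]) (auto simp: smult_assoc1)
qed (use assms in auto)

section \<open>Products \<open>I M\<close> and cyclic submodules\<close>

lemma ideal_smult_subset:
  assumes "module R M" "submodule N R M" "\<And>r x. r \<in> I \<Longrightarrow> x \<in> carrier M \<Longrightarrow> r \<odot>\<^bsub>M\<^esub> x \<in> N"
  shows "ideal_smult R I M \<subseteq> N"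
proof
  fix y assume "y \<in> ideal_smult R I M"
  then show "y \<in> N" by induction (auto intro: assms(3) submoduleD(3)[OF assms(1,2)])
qed

lemma ideal_smult_mono: "I \<subseteq> J \<Longrightarrow> ideal_smult R I M \<subseteq> ideal_smult R J M"
proof
  fix y assume IJ: "I \<subseteq> J" and "y \<in> ideal_smult R I M"
  from this(2) show "y \<in> ideal_smult R J M"
    by induction (use IJ in \<open>auto intro: ideal_smult.intros\<close>)
qed

text \<open>Write R x as I M. The inclusion of I M in R x puts \<open>I\<close> among the cyclic
  scalars, and the reverse inclusion puts \<open>x\<close> into I M.\<close>

lemma multiplication_module_cyclic:
  assumes "multiplication_module R M" "x \<in> carrier M"
  obtains I where "ideal I R" "I \<subseteq> cyclic_scalars R M x" "x \<in> ideal_smult R I M"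
proof -
  interpret module R M using assms by (simp add: multiplication_module_def)
  let ?N = "{r \<odot>\<^bsub>M\<^esub> x |r. r \<in> carrier R}"
  obtain I where I: "ideal I R" "?N = ideal_smult R I M"
    using assms submodule_cyclic[of x] unfolding multiplication_module_def by blast
  have "a \<odot>\<^bsub>M\<^esub> m \<in> ?N" if "a \<in> I" "m \<in> carrier M" for a m
    unfolding I(2) using that by (rule ideal_smult.smult)
  then have "I \<subseteq> cyclic_scalars R M x"
    using ideal.Icarr[OF I(1)] by (fastforce simp: cyclic_scalars_def)
  moreover have "\<one>\<^bsub>R\<^esub> \<odot>\<^bsub>M\<^esub> x \<in> ?N" by blast
  then have "x \<in> ideal_smult R I M" using assms(2) I(2) by simp
  ultimately show thesis using that I(1) by blast
qed

text \<open>The scalars that multiply \<open>M\<close> into some finitely generated submodule form an ideal; it is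
  generated by finitely many elements, so a single finitely generated submodule serves all of them.\<close>

lemma multiplication_module_fin_gen:
  assumes R: "cring R" "noetherian_ring R" and mult: "multiplication_module R M"
  shows "fin_gen_module R M"
proof -
  interpret module R M using mult by (simp add: multiplication_module_def)
  interpret N: noetherian_ring R by fact
  \<comment> \<open>The colon ideal of M into the span of \<open>X\<close>; quantifying over all
    submodules containing \<open>X\<close> avoids constructing the span.\<close>
  define T where "T X = {t \<in> carrier R. \<forall>N. submodule N R M \<longrightarrow> X \<subseteq> N \<longrightarrow>
    (\<forall>m\<in>carrier M. t \<odot>\<^bsub>M\<^esub> m \<in> N)}" for X
  have T: "ideal (T X) R" for X
  proof (rule R.idealI_cring, goal_cases)
    case 2 show ?case by (auto simp: T_def submoduleD[OF module_axioms])
  next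
    case (3 s t)
    then show ?case by (auto simp: T_def smult_l_distr submoduleD[OF module_axioms])
  next
    case (4 r t)
    then show ?case by (auto simp: T_def smult_assoc1 submoduleD[OF module_axioms])
  qed (auto simp: T_def)
  have T_mono: "T X \<subseteq> T Y" if "X \<subseteq> Y" for X Y using that unfolding T_def by blast
  \<comment> \<open>The union is directed, since \<open>T X\<close> and \<open>T Y\<close> both lie
    in \<open>T (X \<union> Y)\<close>; this makes it an ideal.\<close>
  define U where "U = (\<Union>X\<in>{X. finite X \<and> X \<subseteq> carrier M}. T X)"
  have U: "ideal U R"
  proof (rule R.idealI_cring, goal_cases)
    case 1 show ?case by (auto simp: U_def T_def)
  next
    case 2
    show ?case unfolding U_def
      using additive_subgroup.zero_closed[OF ideal.axioms(1)[OF T[of "{}"]]] by blast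
  next
    case (3 s t)
    then obtain X Y where XY: "finite X" "X \<subseteq> carrier M" "s \<in> T X" "finite Y" "Y \<subseteq> carrier M" "t \<in> T Y"
      unfolding U_def by blast
    have "s \<oplus>\<^bsub>R\<^esub> t \<in> T (X \<union> Y)"
      using XY T_mono[of X "X \<union> Y"] T_mono[of Y "X \<union> Y"]
      by (intro additive_subgroup.a_closed[OF ideal.axioms(1)[OF T]]) auto
    then show ?case unfolding U_def using XY by blast
  next
    case (4 r t)
    then show ?case unfolding U_def using ideal.I_l_closed[OF T] by blast
  qed
  obtain A where A: "A \<subseteq> carrier R" "finite A" "U = genideal R A"
    using N.finetely_gen[OF U] by blast
  have "\<forall>a\<in>A. \<exists>X. finite X \<and> X \<subseteq> carrier M \<and> a \<in> T X"
    using R.genideal_self[OF A(1)] A(3) unfolding U_def by blast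
  then obtain F where F: "\<forall>a\<in>A. finite (F a) \<and> F a \<subseteq> carrier M \<and> a \<in> T (F a)"
    by metis
  \<comment> \<open>Each of the finitely many generators of \<open>U\<close> needs only a finite
    set, so this finite union serves all of \<open>U\<close>. It will generate M.\<close>
  let ?X = "\<Union>a\<in>A. F a"
  have "A \<subseteq> T ?X" using F T_mono[of _ ?X] by blast
  then have UX: "U \<subseteq> T ?X" unfolding A(3) by (rule R.genideal_minimal[OF T])
  have "N = carrier M" if N: "submodule N R M" "?X \<subseteq> N" for N
  proof
    show "N \<subseteq> carrier M" by (rule submoduleD(1)[OF module_axioms N(1)])
    show "carrier M \<subseteq> N"
    proof
      fix x assume x: "x \<in> carrier M"
      obtain I where I: "ideal I R" "I \<subseteq> cyclic_scalars R M x" "x \<in> ideal_smult R I M"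
        using multiplication_module_cyclic[OF mult x] by blast
      \<comment> \<open>A cyclic scalar maps M into R x, hence into every submodule that contains
        \<open>x\<close>.\<close>
      have "cyclic_scalars R M x \<subseteq> T {x}"
      proof
        fix a assume a: "a \<in> cyclic_scalars R M x"
        have "a \<odot>\<^bsub>M\<^esub> m \<in> L" if L: "submodule L R M" "{x} \<subseteq> L" and m: "m \<in> carrier M" for L m
          using a m submoduleD(4)[OF module_axioms L(1), of _ x] L(2)
          unfolding cyclic_scalars_def by force
        with a show "a \<in> T {x}" unfolding T_def cyclic_scalars_def by blast
      qed
      \<comment> \<open>Now \<open>I\<close> lies in \<open>U\<close> and so in \<open>T ?X\<close>;
        therefore I M is contained in \<open>N\<close>, and \<open>x\<close> belongs to I M.\<close>
      then have "I \<subseteq> U" using I(2) x unfolding U_def by blast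
      then have "ideal_smult R I M \<subseteq> N"
        using UX N unfolding T_def by (intro ideal_smult_subset[OF module_axioms N(1)]) blast
      with I(3) show "x \<in> N" by blast
    qed
  qed
  moreover have "finite ?X" "?X \<subseteq> carrier M" using A(2) F by auto
  ultimately show ?thesis unfolding fin_gen_module_def by blast
qed

text \<open>Nakayama's argument: were the cyclic scalars contained in a maximal ideal \<open>P\<close>, every \<open>x\<close>
  would lie in \<open>P x\<close>, and then some scalar outside \<open>P\<close> would annihilate \<open>M\<close>.\<close>

lemma faithful_multiplication_module_cyclic_scalars:
  assumes R: "cring R" "noetherian_ring R" and M: "faithful_multiplication_module R M"
    and K: "ideal K R"
    and sq: "\<And>x a. x \<in> carrier M \<Longrightarrow> a \<in> cyclic_scalars R M x \<Longrightarrow> a \<otimes>\<^bsub>R\<^esub> a \<in> K"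
  shows "K = carrier R"
proof (rule ccontr)
  assume "K \<noteq> carrier R"
  then obtain P where P: "maximalideal P R" "K \<subseteq> P"
    using noetherian_ring.exists_maximalideal[OF R(2) K] by blast
  have mult: "multiplication_module R M" and ann: "annihilator R M = {\<zero>\<^bsub>R\<^esub>}"
    using M by (auto simp: faithful_multiplication_module_def)
  interpret module R M using mult by (simp add: multiplication_module_def)
  interpret P: primeideal P R by (rule R.maximalideal_prime[OF P(1)])
  \<comment> \<open>The square of a cyclic scalar lies in \<open>K\<close>, hence in
    \<open>P\<close>, and \<open>P\<close> is prime.\<close>
  have sub: "cyclic_scalars R M x \<subseteq> P" if "x \<in> carrier M" for x
    using sq[OF that] P(2) P.I_prime unfolding cyclic_scalars_def by blast
  \<comment> \<open>The ideal \<open>I\<close> with x in I M consists of cyclic scalars and so lies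
    in \<open>P\<close>; thus M = P M.\<close>
  have PM: "x \<in> ideal_smult R P M" if x: "x \<in> carrier M" for x
    using multiplication_module_cyclic[OF mult x] sub[OF x] ideal_smult_mono by (metis subset_iff)
  have Px: "\<exists>p\<in>P. x = p \<odot>\<^bsub>M\<^esub> x" if x: "x \<in> carrier M" for x
  proof -
    obtain I where I: "ideal I R" "I \<subseteq> cyclic_scalars R M x" "x \<in> ideal_smult R I M"
      using multiplication_module_cyclic[OF mult x] by blast
    have add: "\<exists>p\<in>P. y \<oplus>\<^bsub>M\<^esub> z = p \<odot>\<^bsub>M\<^esub> x"
      if yz: "\<exists>p\<in>P. y = p \<odot>\<^bsub>M\<^esub> x" "\<exists>p\<in>P. z = p \<odot>\<^bsub>M\<^esub> x" for y z
    proof -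
      obtain p q where "p \<in> P" "y = p \<odot>\<^bsub>M\<^esub> x" "q \<in> P" "z = q \<odot>\<^bsub>M\<^esub> x" using yz by blast
      then show ?thesis
        using x by (intro bexI[of _ "p \<oplus>\<^bsub>R\<^esub> q"]) (auto simp: smult_l_distr P.Icarr)
    qed
    \<comment> \<open>Since m lies in P M, the element a m lies in P (a M), and a M is contained in
      R x.\<close>
    have gen: "\<exists>p\<in>P. a \<odot>\<^bsub>M\<^esub> m = p \<odot>\<^bsub>M\<^esub> x" if a: "a \<in> I" and m: "m \<in> carrier M" for a m
    proof -
      have aR: "a \<in> carrier R" by (rule ideal.Icarr[OF I(1) a])
      \<comment> \<open>Membership in the carrier is carried through the induction because the sum
        case distributes \<open>a\<close> over both summands.\<close>
      from PM[OF m] have "m \<in> carrier M \<and> (\<exists>p\<in>P. a \<odot>\<^bsub>M\<^esub> m = p \<odot>\<^bsub>M\<^esub> x)"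
      proof induction
        case (smult p m')
        obtain r where r: "r \<in> carrier R" "a \<odot>\<^bsub>M\<^esub> m' = r \<odot>\<^bsub>M\<^esub> x"
          using I(2) a smult(2) unfolding cyclic_scalars_def by blast
        have "a \<odot>\<^bsub>M\<^esub> (p \<odot>\<^bsub>M\<^esub> m') = p \<odot>\<^bsub>M\<^esub> (a \<odot>\<^bsub>M\<^esub> m')"
          using aR smult P.Icarr by (metis smult_assoc1 R.m_comm)
        also have "\<dots> = (p \<otimes>\<^bsub>R\<^esub> r) \<odot>\<^bsub>M\<^esub> x"
          using smult P.Icarr x r by (simp add: smult_assoc1)
        finally show ?case
          using P.I_r_closed[OF smult(1) r(1)] smult P.Icarr by blast
      next
        case (sum y z)
        then show ?case using add[of "a \<odot>\<^bsub>M\<^esub> y" "a \<odot>\<^bsub>M\<^esub> z"] aR by (simp add: smult_r_distr)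
      qed
      then show ?thesis by blast
    qed
    have "\<exists>p\<in>P. y = p \<odot>\<^bsub>M\<^esub> x" if "y \<in> ideal_smult R I M" for y
      using that by induction (rule gen add, assumption+)+
    with I(3) show ?thesis by blast
  qed
  obtain X where X: "X \<subseteq> carrier M" "finite X" "\<And>N. submodule N R M \<Longrightarrow> X \<subseteq> N \<Longrightarrow> N = carrier M"
    using multiplication_module_fin_gen[OF R mult] unfolding fin_gen_module_def by blast
  \<comment> \<open>Each generator satisfies x = p x with p in \<open>P\<close>, so 1 - p kills it
    and lies outside \<open>P\<close>. The product of these scalars stays outside the prime
    \<open>P\<close> and kills all generators.\<close>
  have "\<exists>q\<in>carrier R - P. \<forall>x\<in>X. q \<odot>\<^bsub>M\<^esub> x = \<zero>\<^bsub>M\<^esub>"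
    using X(2,1)
  proof (induction X rule: finite_induct)
    case empty
    then show ?case using P.one_imp_carrier P.I_notcarr by auto
  next
    case (insert x X)
    then obtain q where q: "q \<in> carrier R" "q \<notin> P" "\<forall>x\<in>X. q \<odot>\<^bsub>M\<^esub> x = \<zero>\<^bsub>M\<^esub>" by blast
    have x: "x \<in> carrier M" and XM: "X \<subseteq> carrier M" using insert by auto
    obtain p where p: "p \<in> P" "x = p \<odot>\<^bsub>M\<^esub> x" using Px[OF x] by blast
    have pR: "p \<in> carrier R" using p(1) by (rule P.Icarr)
    let ?s = "\<one>\<^bsub>R\<^esub> \<ominus>\<^bsub>R\<^esub> p"
    have s: "?s \<in> carrier R" using pR by simp
    have "?s \<notin> P"
    proof
      assume "?s \<in> P"
      then have "?s \<oplus>\<^bsub>R\<^esub> p \<in> P" using p(1) by blast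
      moreover have "?s \<oplus>\<^bsub>R\<^esub> p = \<one>\<^bsub>R\<^esub>" using pR by (simp add: R.minus_eq R.a_assoc R.l_neg)
      ultimately show False using P.one_imp_carrier P.I_notcarr by auto
    qed
    then have "q \<otimes>\<^bsub>R\<^esub> ?s \<notin> P" using P.I_prime[OF q(1) s] q(2) by blast
    moreover have "?s \<odot>\<^bsub>M\<^esub> x = \<zero>\<^bsub>M\<^esub>"
      using x pR p(2) by (simp add: R.minus_eq smult_l_distr smult_l_minus M.r_neg)
    moreover have "(q \<otimes>\<^bsub>R\<^esub> ?s) \<odot>\<^bsub>M\<^esub> y = \<zero>\<^bsub>M\<^esub>" if "y \<in> X" for y
    proof -
      have "y \<in> carrier M" using that XM by blast
      then have "(q \<otimes>\<^bsub>R\<^esub> ?s) \<odot>\<^bsub>M\<^esub> y = ?s \<odot>\<^bsub>M\<^esub> (q \<odot>\<^bsub>M\<^esub> y)"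
        using q(1) s by (metis smult_assoc1 R.m_comm)
      then show ?thesis using q(3) that s by simp
    qed
    ultimately show ?case
      using q(1) s x by (intro bexI[of _ "q \<otimes>\<^bsub>R\<^esub> ?s"]) (auto simp: smult_assoc1)
  qed
  then obtain q where q: "q \<in> carrier R" "q \<notin> P" "\<forall>x\<in>X. q \<odot>\<^bsub>M\<^esub> x = \<zero>\<^bsub>M\<^esub>" by blast
  \<comment> \<open>The elements killed by \<open>q\<close> form a submodule containing the
    generators, so \<open>q\<close> annihilates M. Faithfulness forces q = 0, which lies in
    \<open>P\<close>.\<close>
  have "submodule {m \<in> carrier M. q \<odot>\<^bsub>M\<^esub> m = \<zero>\<^bsub>M\<^esub>} R M"
  proof (rule submoduleI'[OF module_axioms], goal_cases)
    case (4 r m)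
    then have "q \<odot>\<^bsub>M\<^esub> (r \<odot>\<^bsub>M\<^esub> m) = r \<odot>\<^bsub>M\<^esub> (q \<odot>\<^bsub>M\<^esub> m)"
      using q(1) by (metis (no_types, lifting) mem_Collect_eq smult_assoc1 R.m_comm)
    with 4 show ?case by simp
  qed (use q(1) in \<open>auto simp: smult_r_distr\<close>)
  then have "{m \<in> carrier M. q \<odot>\<^bsub>M\<^esub> m = \<zero>\<^bsub>M\<^esub>} = carrier M"
    by (rule X(3)) (use X(1) q(3) in auto)
  then have "q \<in> annihilator R M" using q(1) by (auto simp: annihilator_def)
  with q(2) ann P.zero_closed show False by simp
qed

text \<open>If \<open>a M \<subseteq> R x\<close> and \<open>M\<close> is faithful, then \<open>a\<close> kills the annihilator of \<open>x\<close>, so \<open>m \<mapsto> a r\<close> with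
  \<open>a m = r x\<close> is well defined.\<close>

lemma cyclic_scalars_maps:
  assumes M: "module R M" and ann: "annihilator R M = {\<zero>\<^bsub>R\<^esub>}"
    and x: "x \<in> carrier M" and a: "a \<in> cyclic_scalars R M x"
  obtains f g where "f \<in> module_homs R M (self_module R)" "g \<in> module_homs R (self_module R) M"
    "\<forall>m\<in>carrier M. g (f m) = (a \<otimes>\<^bsub>R\<^esub> a) \<odot>\<^bsub>M\<^esub> m"
    "\<forall>r\<in>carrier R. f (g r) = (a \<otimes>\<^bsub>R\<^esub> a) \<otimes>\<^bsub>R\<^esub> r"
proof -
  interpret module R M by fact
  have aR: "a \<in> carrier R" using a by (simp add: cyclic_scalars_def)
  have ex: "\<exists>r\<in>carrier R. a \<odot>\<^bsub>M\<^esub> m = r \<odot>\<^bsub>M\<^esub> x" if "m \<in> carrier M" for m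
    using a that by (auto simp: cyclic_scalars_def)
  \<comment> \<open>With a m = r x one gets a s m = s r x = r (s x) = 0 for every m, so faithfulness
    applies to a s.\<close>
  have kill: "a \<otimes>\<^bsub>R\<^esub> s = \<zero>\<^bsub>R\<^esub>" if s: "s \<in> carrier R" "s \<odot>\<^bsub>M\<^esub> x = \<zero>\<^bsub>M\<^esub>" for s
  proof -
    have "(a \<otimes>\<^bsub>R\<^esub> s) \<odot>\<^bsub>M\<^esub> m = \<zero>\<^bsub>M\<^esub>" if m: "m \<in> carrier M" for m
    proof -
      obtain r where r: "r \<in> carrier R" "a \<odot>\<^bsub>M\<^esub> m = r \<odot>\<^bsub>M\<^esub> x" using ex[OF m] by blast
      have "(a \<otimes>\<^bsub>R\<^esub> s) \<odot>\<^bsub>M\<^esub> m = s \<odot>\<^bsub>M\<^esub> (r \<odot>\<^bsub>M\<^esub> x)"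
        using aR s m r by (metis smult_assoc1 R.m_comm)
      also have "\<dots> = r \<odot>\<^bsub>M\<^esub> (s \<odot>\<^bsub>M\<^esub> x)" using s r x by (metis smult_assoc1 R.m_comm)
      finally show ?thesis using s r by simp
    qed
    then have "a \<otimes>\<^bsub>R\<^esub> s \<in> annihilator R M" using aR s by (simp add: annihilator_def)
    then show ?thesis using ann by simp
  qed
  have indep: "a \<otimes>\<^bsub>R\<^esub> r = a \<otimes>\<^bsub>R\<^esub> s"
    if rs: "r \<in> carrier R" "s \<in> carrier R" "r \<odot>\<^bsub>M\<^esub> x = s \<odot>\<^bsub>M\<^esub> x" for r s
  proof -
    have "(r \<ominus>\<^bsub>R\<^esub> s) \<odot>\<^bsub>M\<^esub> x = \<zero>\<^bsub>M\<^esub>"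
      using rs x by (simp add: R.minus_eq smult_l_distr smult_l_minus M.r_neg)
    then have "a \<otimes>\<^bsub>R\<^esub> (r \<ominus>\<^bsub>R\<^esub> s) = \<zero>\<^bsub>R\<^esub>" using rs by (intro kill) auto
    then have "a \<otimes>\<^bsub>R\<^esub> r \<ominus>\<^bsub>R\<^esub> a \<otimes>\<^bsub>R\<^esub> s = \<zero>\<^bsub>R\<^esub>"
      using aR rs by (simp add: R.minus_eq R.r_distr R.r_minus)
    then show ?thesis using aR rs by simp
  qed
  \<comment> \<open>The scalar r with a m = r x is determined only up to the annihilator of x; the
    extra factor \<open>a\<close> removes this ambiguity.\<close>
  define f where "f = (\<lambda>m\<in>carrier M. a \<otimes>\<^bsub>R\<^esub> (SOME r. r \<in> carrier R \<and> a \<odot>\<^bsub>M\<^esub> m = r \<odot>\<^bsub>M\<^esub> x))"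
  have f: "f m = a \<otimes>\<^bsub>R\<^esub> r" if m: "m \<in> carrier M" and r: "r \<in> carrier R" "a \<odot>\<^bsub>M\<^esub> m = r \<odot>\<^bsub>M\<^esub> x" for m r
  proof -
    let ?s = "SOME r. r \<in> carrier R \<and> a \<odot>\<^bsub>M\<^esub> m = r \<odot>\<^bsub>M\<^esub> x"
    have "?s \<in> carrier R \<and> a \<odot>\<^bsub>M\<^esub> m = ?s \<odot>\<^bsub>M\<^esub> x"
      by (rule someI[of _ r]) (use r in blast)
    then have "a \<otimes>\<^bsub>R\<^esub> ?s = a \<otimes>\<^bsub>R\<^esub> r" using r by (intro indep) auto
    then show ?thesis unfolding f_def using m by simp
  qed
  define g where "g = (\<lambda>r\<in>carrier R. r \<odot>\<^bsub>M\<^esub> x)"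
  show thesis
  proof
    show "f \<in> module_homs R M (self_module R)"
    proof (rule module_homI)
      have "f m \<in> carrier R" if "m \<in> carrier M" for m using ex[OF that] f[OF that] aR by auto
      then show "f \<in> carrier M \<rightarrow>\<^sub>E carrier (self_module R)"
        by (auto simp: self_module_def f_def)
    next
      fix m m' assume m: "m \<in> carrier M" "m' \<in> carrier M"
      then obtain r r' where r: "r \<in> carrier R" "a \<odot>\<^bsub>M\<^esub> m = r \<odot>\<^bsub>M\<^esub> x"
        "r' \<in> carrier R" "a \<odot>\<^bsub>M\<^esub> m' = r' \<odot>\<^bsub>M\<^esub> x" using ex by metis
      have "f (m \<oplus>\<^bsub>M\<^esub> m') = a \<otimes>\<^bsub>R\<^esub> (r \<oplus>\<^bsub>R\<^esub> r')"
        using m r aR x by (intro f) (auto simp: smult_l_distr smult_r_distr)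
      then show "f (m \<oplus>\<^bsub>M\<^esub> m') = f m \<oplus>\<^bsub>self_module R\<^esub> f m'"
        using f[OF m(1) r(1,2)] f[OF m(2) r(3,4)] aR r by (simp add: self_module_def R.r_distr)
    next
      fix s m assume s: "s \<in> carrier R" and m: "m \<in> carrier M"
      then obtain r where r: "r \<in> carrier R" "a \<odot>\<^bsub>M\<^esub> m = r \<odot>\<^bsub>M\<^esub> x" using ex by metis
      have "a \<odot>\<^bsub>M\<^esub> (s \<odot>\<^bsub>M\<^esub> m) = s \<odot>\<^bsub>M\<^esub> (a \<odot>\<^bsub>M\<^esub> m)"
        using s m aR by (metis smult_assoc1 R.m_comm)
      then have "f (s \<odot>\<^bsub>M\<^esub> m) = a \<otimes>\<^bsub>R\<^esub> (s \<otimes>\<^bsub>R\<^esub> r)"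
        using m r s x by (intro f) (auto simp: smult_assoc1)
      then show "f (s \<odot>\<^bsub>M\<^esub> m) = s \<odot>\<^bsub>self_module R\<^esub> f m"
        using f[OF m r] aR r s by (simp add: self_module_def R.m_lcomm)
    qed
    show "g \<in> module_homs R (self_module R) M"
      using x by (intro module_homI) (auto simp: g_def self_module_def smult_l_distr smult_assoc1)
    show "\<forall>m\<in>carrier M. g (f m) = (a \<otimes>\<^bsub>R\<^esub> a) \<odot>\<^bsub>M\<^esub> m"
    proof
      fix m assume m: "m \<in> carrier M"
      obtain r where r: "r \<in> carrier R" "a \<odot>\<^bsub>M\<^esub> m = r \<odot>\<^bsub>M\<^esub> x" using ex[OF m] by blast
      then show "g (f m) = (a \<otimes>\<^bsub>R\<^esub> a) \<odot>\<^bsub>M\<^esub> m"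
        using f[OF m r] aR x m by (simp add: g_def smult_assoc1)
    qed
    show "\<forall>r\<in>carrier R. f (g r) = (a \<otimes>\<^bsub>R\<^esub> a) \<otimes>\<^bsub>R\<^esub> r"
    proof
      fix r assume r: "r \<in> carrier R"
      \<comment> \<open>Here a (r x) = (a r) x, so a r is a representative at which \<open>f\<close>
        can be evaluated.\<close>
      have "f (r \<odot>\<^bsub>M\<^esub> x) = a \<otimes>\<^bsub>R\<^esub> (a \<otimes>\<^bsub>R\<^esub> r)"
        using r x aR by (intro f) (auto simp: smult_assoc1)
      then show "f (g r) = (a \<otimes>\<^bsub>R\<^esub> a) \<otimes>\<^bsub>R\<^esub> r" using r aR by (simp add: g_def R.m_assoc)
    qed
  qed
qed


section \<open>Cochains\<close>


lemma module_homs_eqI: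
  assumes "g \<in> module_homs R L N" "h \<in> module_homs R L N" "\<And>x. x \<in> carrier L \<Longrightarrow> g x = h x"
  shows "g = h"
  using assms by (intro PiE_ext[of g "carrier L" "\<lambda>_. carrier N" h]) (auto simp: module_homs_def)

lemma hom_module_simps:
  "carrier (hom_module R L N) = module_homs R L N"
  "\<zero>\<^bsub>hom_module R L N\<^esub> = (\<lambda>x\<in>carrier L. \<zero>\<^bsub>N\<^esub>)"
  "g \<oplus>\<^bsub>hom_module R L N\<^esub> h = (\<lambda>x\<in>carrier L. g x \<oplus>\<^bsub>N\<^esub> h x)"
  "r \<odot>\<^bsub>hom_module R L N\<^esub> h = (\<lambda>x\<in>carrier L. r \<odot>\<^bsub>N\<^esub> h x)"
  by (simp_all add: hom_module_def)

lemma module_hom_module: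
  assumes L: "module R L" and N: "module R N"
  shows "module R (hom_module R L N)"
proof -
  interpret L: module R L by fact
  interpret N: module R N by fact
  let ?H = "hom_module R L N"
  have zero: "\<zero>\<^bsub>?H\<^esub> \<in> carrier ?H"
    unfolding hom_module_simps by (rule module_homI) auto
  have add: "g \<oplus>\<^bsub>?H\<^esub> h \<in> carrier ?H" if gh: "g \<in> carrier ?H" "h \<in> carrier ?H" for g h
  proof -
    note D = gh[unfolded hom_module_simps]
    show ?thesis
      unfolding hom_module_simps
      by (rule module_homI)
         (auto simp: module_homD[OF D(1)] module_homD[OF D(2)] N.M.a_ac N.smult_r_distr)
  qed
  have smult: "r \<odot>\<^bsub>?H\<^esub> h \<in> carrier ?H" if r: "r \<in> carrier R" and h: "h \<in> carrier ?H" for r h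
  proof -
    note D = h[unfolded hom_module_simps]
    \<comment> \<open>Commutativity of R is what makes a scalar multiple of a homomorphism linear
      again.\<close>
    have "r \<odot>\<^bsub>N\<^esub> (s \<odot>\<^bsub>N\<^esub> y) = s \<odot>\<^bsub>N\<^esub> (r \<odot>\<^bsub>N\<^esub> y)" if "s \<in> carrier R" "y \<in> carrier N" for s y
      using r that by (metis N.smult_assoc1 L.m_comm)
    then show ?thesis
      unfolding hom_module_simps using r
      by (intro module_homI) (auto simp: module_homD[OF D] N.smult_r_distr)
  qed
  have neg: "\<exists>g\<in>carrier ?H. g \<oplus>\<^bsub>?H\<^esub> h = \<zero>\<^bsub>?H\<^esub>" if h: "h \<in> carrier ?H" for h
  proof
    show "(\<ominus>\<^bsub>R\<^esub> \<one>\<^bsub>R\<^esub>) \<odot>\<^bsub>?H\<^esub> h \<in> carrier ?H" using h by (intro smult) auto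
    show "(\<ominus>\<^bsub>R\<^esub> \<one>\<^bsub>R\<^esub>) \<odot>\<^bsub>?H\<^esub> h \<oplus>\<^bsub>?H\<^esub> h = \<zero>\<^bsub>?H\<^esub>"
      using module_homD(1)[OF h[unfolded hom_module_simps]]
      by (auto simp: hom_module_simps N.smult_l_minus N.M.l_neg intro!: restrict_ext)
  qed
  note eqI = module_homs_eqI[of _ R L N, folded hom_module_simps(1)]
  note nth = module_homD(1)[of _ R L N, folded hom_module_simps(1)]
  show ?thesis
  proof (intro moduleI abelian_groupI)
    fix x assume x: "x \<in> carrier ?H"
    then show "\<exists>y\<in>carrier ?H. y \<oplus>\<^bsub>?H\<^esub> x = \<zero>\<^bsub>?H\<^esub>" by (rule neg)
    show "\<zero>\<^bsub>?H\<^esub> \<oplus>\<^bsub>?H\<^esub> x = x" using nth[OF x]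
      by (intro eqI add zero x) (simp add: hom_module_simps(2-4))
    show "\<one>\<^bsub>R\<^esub> \<odot>\<^bsub>?H\<^esub> x = x" using nth[OF x]
      by (intro eqI smult x L.one_closed) (simp add: hom_module_simps(2-4))
  qed (rule L.is_cring zero add smult; assumption | simp add: hom_module_simps(2-4) nth N.M.a_ac
        N.smult_l_distr N.smult_r_distr N.smult_assoc1 cong: restrict_cong)+
qed

lemma module_cochains: "module R M \<Longrightarrow> module R (cochains R P M i)"
  unfolding cochains_def by (intro module_hom_module module_free_module module.axioms(1))

text \<open>Members of \<open>module_homs\<close> are extensional, whereas \<open>codiff\<close>
  acts on arbitrary functions; hence the restriction in the second claim.\<close>

lemma codiff_hom:
  assumes M: "module R M"
    and d: "diff P i \<in> module_homs R (res_module R P (Suc i)) (res_module R P i)"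
  shows "codiff R P i \<in> carrier (cochains R P M i) \<rightarrow> carrier (cochains R P M (Suc i))"
    and "restrict (codiff R P i) (carrier (cochains R P M i)) \<in>
      module_homs R (cochains R P M i) (cochains R P M (Suc i))"
proof -
  note F = module_free_module[OF module.axioms(1)[OF M]]
  show *: "codiff R P i \<in> carrier (cochains R P M i) \<rightarrow> carrier (cochains R P M (Suc i))"
    unfolding cochains_def codiff_def hom_module_simps using module_homs_comp[OF F d] by blast
  interpret C: module R "cochains R P M i" by (rule module_cochains[OF M])
  have "codiff R P i (y \<oplus>\<^bsub>cochains R P M i\<^esub> z) =
      codiff R P i y \<oplus>\<^bsub>cochains R P M (Suc i)\<^esub> codiff R P i z"
    "codiff R P i (r \<odot>\<^bsub>cochains R P M i\<^esub> z) = r \<odot>\<^bsub>cochains R P M (Suc i)\<^esub> codiff R P i z" for r y z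
    by (auto simp: codiff_def cochains_def hom_module_simps module_homD(1)[OF d] intro!: restrict_ext)
  then show "restrict (codiff R P i) (carrier (cochains R P M i)) \<in>
      module_homs R (cochains R P M i) (cochains R P M (Suc i))"
    using * by (intro module_homI) auto
qed

lemma cocycles_iff:
  "z \<in> cocycles R P M i \<longleftrightarrow>
    z \<in> module_homs R (res_module R P i) M \<and>
    codiff R P i z = (\<lambda>x\<in>carrier (res_module R P (Suc i)). \<zero>\<^bsub>M\<^esub>)"
  by (auto simp: cocycles_def a_kernel_def kernel_def cochains_def hom_module_simps)

lemma submodule_coboundaries:
  assumes M: "module R M"
    and d: "\<And>k. diff P k \<in> module_homs R (res_module R P (Suc k)) (res_module R P k)"
  shows "submodule (coboundaries R P M i) R (cochains R P M i)"
proof (cases i)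
  case 0
  interpret C: module R "cochains R P M 0" by (rule module_cochains[OF M])
  show ?thesis
    unfolding 0 coboundaries_def by (rule submoduleI'[OF C.module_axioms]) auto
next
  case (Suc j)
  show ?thesis
    using submodule_image[OF module_cochains[OF M] module_cochains[OF M] codiff_hom(2)[OF M d[of j]]]
    by (simp add: Suc coboundaries_def)
qed

text \<open>This tests whether a class in the quotient by \<open>B\<close> vanishes, as the zero of
  that quotient is \<open>B\<close> itself.\<close>

lemma coset_eq_submodule_iff:
  assumes "module R M" "submodule B R M" "z \<in> carrier M"
  shows "B +>\<^bsub>M\<^esub> z = B \<longleftrightarrow> z \<in> B"
proof -
  interpret M: module R M by fact
  interpret A: abelian_subgroup B M
    by (rule abelian_subgroupI3[OF _ M.M.abelian_group_axioms])
       (rule additive_subgroup.intro[OF submodule.axioms(1)[OF assms(2)]])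
  show ?thesis using A.a_rcos_self[OF assms(3)] A.a_rcos_const by auto
qed


section \<open>Direct limits\<close>

lemma transition_add: "transition f n (i + j) x = transition f (n + i) j (transition f n i x)"
  by (induction j) (auto simp: add.assoc)

lemma transition_zero:
  assumes "\<And>n. f n \<zero>\<^bsub>E n\<^esub> = \<zero>\<^bsub>E (Suc n)\<^esub>"
  shows "transition f n j \<zero>\<^bsub>E n\<^esub> = \<zero>\<^bsub>E (n + j)\<^esub>"
  by (induction j) (auto simp: assms)

text \<open>An element dies in the limit iff it dies at a finite stage. One direction reads this off
  from the membership of \<open>(n, x)\<close> in its own class; the other compares both classes
  beyond the stage where \<open>x\<close> has become zero.\<close>

lemma limit_class_eq_zero_iff:
  assumes f0: "\<And>n. f n \<zero>\<^bsub>E n\<^esub> = \<zero>\<^bsub>E (Suc n)\<^esub>" and x: "x \<in> carrier (E n)"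
  shows "limit_class E f n x = limit_class E f 0 \<zero>\<^bsub>E 0\<^esub> \<longleftrightarrow>
    (\<exists>j. transition f n j x = \<zero>\<^bsub>E (n + j)\<^esub>)"
proof
  note t0 = transition_zero[of f E, OF f0]
  assume eq: "limit_class E f n x = limit_class E f 0 \<zero>\<^bsub>E 0\<^esub>"
  have "transition f n 0 x = transition f n 0 x" ..
  then have "(n, x) \<in> limit_class E f n x" using x unfolding limit_class_def by blast
  then have "(n, x) \<in> limit_class E f 0 \<zero>\<^bsub>E 0\<^esub>" by (simp only: eq)
  then obtain i j where "i = n + j" "transition f 0 i \<zero>\<^bsub>E 0\<^esub> = transition f n j x"
    by (auto simp: limit_class_def)
  then show "\<exists>j. transition f n j x = \<zero>\<^bsub>E (n + j)\<^esub>" using t0[of 0 i] by auto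
next
  note t0 = transition_zero[of f E, OF f0]
  assume "\<exists>j. transition f n j x = \<zero>\<^bsub>E (n + j)\<^esub>"
  then obtain k where k: "transition f n k x = \<zero>\<^bsub>E (n + k)\<^esub>" ..
  \<comment> \<open>From stage n + k on, every image of \<open>x\<close> is zero.\<close>
  have k': "transition f n (k + j) x = \<zero>\<^bsub>E (n + k + j)\<^esub>" for j
    by (simp add: transition_add k t0)
  have "(m, y) \<in> limit_class E f n x \<longleftrightarrow> (m, y) \<in> limit_class E f 0 \<zero>\<^bsub>E 0\<^esub>" for m y
  proof
    assume "(m, y) \<in> limit_class E f n x"
    then obtain i j where ij: "y \<in> carrier (E m)" "n + i = m + j" "transition f n i x = transition f m j y"
      by (auto simp: limit_class_def)
    have "transition f m (j + k) y = transition f n (i + k) x"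
      by (simp add: transition_add ij)
    also have "\<dots> = transition f 0 (m + (j + k)) \<zero>\<^bsub>E 0\<^esub>"
    proof -
      have "n + k + i = m + (j + k)" using ij(2) by simp
      then show ?thesis using k'[of i] t0[of 0 "m + (j + k)"] by (simp only: add.commute[of i k] add_0)
    qed
    finally show "(m, y) \<in> limit_class E f 0 \<zero>\<^bsub>E 0\<^esub>"
      unfolding limit_class_def using ij(1) by (auto intro!: exI[of _ "m + (j + k)"] exI[of _ "j + k"])
  next
    assume "(m, y) \<in> limit_class E f 0 \<zero>\<^bsub>E 0\<^esub>"
    then obtain i j where ij: "y \<in> carrier (E m)" "i = m + j" "transition f 0 i \<zero>\<^bsub>E 0\<^esub> = transition f m j y"
      by (auto simp: limit_class_def)
    \<comment> \<open>Both elements are pushed to the common stage n + k + m + j, where each of them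
      is zero.\<close>
    have "transition f m (j + (n + k)) y = \<zero>\<^bsub>E (m + (j + (n + k)))\<^esub>"
      using ij(3) t0[of 0 i] t0[of i "n + k"] ij(2) by (simp add: transition_add[of f m j] ac_simps)
    also have "\<dots> = transition f n (k + (m + j)) x"
      using k'[of "m + j"] by (simp add: ac_simps)
    finally have "transition f n (k + (m + j)) x = transition f m (j + (n + k)) y" ..
    moreover have "n + (k + (m + j)) = m + (j + (n + k))" by simp
    ultimately show "(m, y) \<in> limit_class E f n x"
      unfolding limit_class_def using ij(1) by blast
  qed
  then show "limit_class E f n x = limit_class E f 0 \<zero>\<^bsub>E 0\<^esub>" by auto
qed

text \<open>The assumption on \<open>E 0\<close> puts the zero class into the carrier of the limit,
  so the limit is zero exactly when every class equals that one.\<close>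

lemma zero_module_direct_limit_iff:
  assumes f0: "\<And>n. f n \<zero>\<^bsub>E n\<^esub> = \<zero>\<^bsub>E (Suc n)\<^esub>" and z: "\<zero>\<^bsub>E 0\<^esub> \<in> carrier (E 0)"
  shows "zero_module (direct_limit E f) \<longleftrightarrow>
    (\<forall>n. \<forall>x\<in>carrier (E n). \<exists>j. transition f n j x = \<zero>\<^bsub>E (n + j)\<^esub>)"
proof -
  have "zero_module (direct_limit E f) \<longleftrightarrow>
    (\<forall>n. \<forall>x\<in>carrier (E n). limit_class E f n x = limit_class E f 0 \<zero>\<^bsub>E 0\<^esub>)"
    unfolding zero_module_def direct_limit_def using z by auto
  then show ?thesis using limit_class_eq_zero_iff[of f E, OF f0] by simp
qed


section \<open>Towers of resolutions\<close>

text \<open>In the application \<open>P n\<close> resolves R/\<aa>^n and \<open>\<phi> n\<close>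
  lifts the projection from R/\<aa>^(n+1) to R/\<aa>^n.\<close>

locale resolution_tower = cring R for R :: "('a, 'c) ring_scheme" (structure) +
  fixes P :: "nat \<Rightarrow> ('a, 'n) resolution"
    and \<phi> :: "nat \<Rightarrow> nat \<Rightarrow> (nat \<Rightarrow> 'a) \<Rightarrow> nat \<Rightarrow> 'a"
  assumes diff_hom: "diff (P n) k \<in> module_homs R (res_module R (P n) (Suc k)) (res_module R (P n) k)"
    and lift_hom: "\<phi> n k \<in> module_homs R (res_module R (P (Suc n)) k) (res_module R (P n) k)"
    and lift_diff: "x \<in> carrier (res_module R (P (Suc n)) (Suc k)) \<Longrightarrow>
      diff (P n) k (\<phi> n (Suc k) x) = \<phi> n k (diff (P (Suc n)) k x)"
begin

text \<open>The effect of \<open>Ext_map\<close> on representatives: cochains at stage n become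
  cochains at stage n + 1.\<close>

definition pullback :: "nat \<Rightarrow> nat \<Rightarrow> ((nat \<Rightarrow> 'a) \<Rightarrow> 'b) \<Rightarrow> (nat \<Rightarrow> 'a) \<Rightarrow> 'b"
  where "pullback i n z = (\<lambda>x\<in>carrier (res_module R (P (Suc n)) i). z (\<phi> n i x))"

text \<open>Triviality of the limit of the Ext modules, phrased with cocycles so that neither cosets
  nor limit classes appear.\<close>

definition vanishing :: "nat \<Rightarrow> ('a, 'b, 'd) module_scheme \<Rightarrow> bool"
  where "vanishing i M \<longleftrightarrow> (\<forall>n. \<forall>z\<in>cocycles R (P n) M i. \<exists>j.
    transition (pullback i) n j z \<in> coboundaries R (P (n + j)) M i)"

section \<open>Compatibility of pullbacks with the cochain complexes\<close>

lemmas module_res = module_free_module[OF is_cring]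
lemmas lift_closed = module_homD(1)[OF lift_hom]
lemmas diff_closed = module_homD(1)[OF diff_hom]

lemma pullback_closed:
  "z \<in> carrier (cochains R (P n) M i) \<Longrightarrow> pullback i n z \<in> carrier (cochains R (P (Suc n)) M i)"
  unfolding cochains_def hom_module_simps pullback_def by (rule module_homs_comp[OF module_res lift_hom])

lemma pullback_add:
  "pullback i n (y \<oplus>\<^bsub>cochains R (P n) M i\<^esub> z) =
    pullback i n y \<oplus>\<^bsub>cochains R (P (Suc n)) M i\<^esub> pullback i n z"
  by (auto simp: pullback_def cochains_def hom_module_simps lift_closed intro!: restrict_ext)

lemma pullback_smult:
  "pullback i n (r \<odot>\<^bsub>cochains R (P n) M i\<^esub> z) = r \<odot>\<^bsub>cochains R (P (Suc n)) M i\<^esub> pullback i n z"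
  by (auto simp: pullback_def cochains_def hom_module_simps lift_closed intro!: restrict_ext)

lemma pullback_zero: "pullback i n \<zero>\<^bsub>cochains R (P n) M i\<^esub> = \<zero>\<^bsub>cochains R (P (Suc n)) M i\<^esub>"
  by (auto simp: pullback_def cochains_def hom_module_simps lift_closed intro!: restrict_ext)

text \<open>By the commuting squares \<open>lift_diff\<close>, pulling back is a map of cochain
  complexes; this is why it preserves cocycles and coboundaries.\<close>

lemma codiff_pullback:
  "codiff R (P (Suc n)) i (pullback i n z) = pullback (Suc i) n (codiff R (P n) i z)"
  by (auto simp: pullback_def codiff_def lift_closed diff_closed lift_diff intro!: restrict_ext)

lemma pullback_cocycle:
  "z \<in> cocycles R (P n) M i \<Longrightarrow> pullback i n z \<in> cocycles R (P (Suc n)) M i"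
  using pullback_closed[of z n M i] pullback_zero[of "Suc i" n M]
  by (auto simp: cocycles_iff codiff_pullback cochains_def hom_module_simps)

lemma pullback_coboundary:
  assumes "z \<in> coboundaries R (P n) M i" shows "pullback i n z \<in> coboundaries R (P (Suc n)) M i"
proof (cases i)
  case 0
  then show ?thesis using assms pullback_zero by (simp add: coboundaries_def)
next
  case (Suc j)
  then obtain w where "w \<in> carrier (cochains R (P n) M j)" "z = codiff R (P n) j w"
    using assms by (auto simp: coboundaries_def)
  then show ?thesis
    using pullback_closed[of w n M j] by (auto simp: Suc coboundaries_def codiff_pullback[symmetric])
qed

lemma transition_cocycle:
  "z \<in> cocycles R (P n) M i \<Longrightarrow> transition (pullback i) n j z \<in> cocycles R (P (n + j)) M i"
  by (induction j) (auto intro: pullback_cocycle)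

text \<open>Transitions change the argument of a cochain and \<open>u\<close> changes its value, so
  the two operations commute.\<close>

lemma postcompose_transition:
  "transition (pullback i) n j (\<lambda>x\<in>carrier (res_module R (P n) i). u (z x)) =
    (\<lambda>x\<in>carrier (res_module R (P (n + j)) i). u (transition (pullback i) n j z x))"
  by (induction j) (auto simp: pullback_def lift_closed intro!: restrict_ext)

lemma codiff_postcompose:
  "codiff R (P n) i (\<lambda>x\<in>carrier (res_module R (P n) i). u (z x)) =
    (\<lambda>x\<in>carrier (res_module R (P n) (Suc i)). u (codiff R (P n) i z x))"
  by (auto simp: codiff_def diff_closed intro!: restrict_ext)

lemma postcompose_cocycle:
  assumes "module R M" "module R N" "u \<in> module_homs R M N" "z \<in> cocycles R (P n) M i"
  shows "(\<lambda>x\<in>carrier (res_module R (P n) i). u (z x)) \<in> cocycles R (P n) N i"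
  using assms(4) module_homs_comp[OF module_res _ assms(3), of z]
  by (auto simp: cocycles_iff codiff_postcompose module_hom_zero[OF assms(1-3)] intro!: restrict_ext)

lemma postcompose_coboundary:
  assumes "module R M" "module R N" "u \<in> module_homs R M N" "z \<in> coboundaries R (P n) M i"
  shows "(\<lambda>x\<in>carrier (res_module R (P n) i). u (z x)) \<in> coboundaries R (P n) N i"
proof (cases i)
  case 0
  then show ?thesis
    using assms(4) module_hom_zero[OF assms(1-3)]
    by (auto simp: coboundaries_def cochains_def hom_module_simps intro!: restrict_ext)
next
  case (Suc j)
  then obtain w where w: "w \<in> carrier (cochains R (P n) M j)" "z = codiff R (P n) j w"
    using assms by (auto simp: coboundaries_def)
  have "(\<lambda>x\<in>carrier (res_module R (P n) j). u (w x)) \<in> carrier (cochains R (P n) N j)"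
    using w(1) module_homs_comp[OF module_res _ assms(3)] by (simp add: cochains_def hom_module_simps)
  then have "codiff R (P n) j (\<lambda>x\<in>carrier (res_module R (P n) j). u (w x)) \<in> coboundaries R (P n) N (Suc j)"
    by (simp add: coboundaries_def)
  then show ?thesis by (simp only: codiff_postcompose w(2) Suc)
qed

text \<open>The scalars \<open>t\<close> for which \<open>t z\<close> eventually becomes a coboundary form an ideal, and it contains
  every \<open>c\<close> such that multiplication by \<open>c\<close> on \<open>M\<close> factors through \<open>N\<close>.\<close>

lemma vanishing_transfer:
  assumes M: "module R M" and N: "module R N" and van: "vanishing i N"
    and gen: "\<And>K. ideal K R \<Longrightarrow> (\<And>c u v. c \<in> carrier R \<Longrightarrow> u \<in> module_homs R M N \<Longrightarrow>
      v \<in> module_homs R N M \<Longrightarrow> (\<And>m. m \<in> carrier M \<Longrightarrow> v (u m) = c \<odot>\<^bsub>M\<^esub> m) \<Longrightarrow> c \<in> K) \<Longrightarrow> K = carrier R"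
  shows "vanishing i M"
  unfolding vanishing_def
proof (intro allI ballI)
  fix n z assume z: "z \<in> cocycles R (P n) M i"
  let ?C = "\<lambda>j. cochains R (P (n + j)) M i" and ?B = "\<lambda>j. coboundaries R (P (n + j)) M i"
    and ?z = "\<lambda>j. transition (pullback i) n j z"
  note B = submoduleD[OF module_cochains[OF M] submodule_coboundaries[OF M diff_hom]]
  have zc: "?z j \<in> carrier (?C j)" for j
    using transition_cocycle[OF z, of j] by (simp add: cocycles_iff cochains_def hom_module_simps)
  define K where "K = {t \<in> carrier R. \<exists>j. t \<odot>\<^bsub>?C j\<^esub> ?z j \<in> ?B j}"
  \<comment> \<open>Two scalars in \<open>K\<close> may succeed at different stages; this
    persistence brings them to a common one when their sum is formed.\<close>
  have mono: "t \<odot>\<^bsub>?C (j + k)\<^esub> ?z (j + k) \<in> ?B (j + k)" if "t \<odot>\<^bsub>?C j\<^esub> ?z j \<in> ?B j" for t j k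
  proof (induction k)
    case (Suc k)
    then show ?case
      using pullback_coboundary[OF Suc] pullback_smult[of i "n + (j + k)" M t "?z (j + k)"] by simp
  qed (use that in simp)
  have "ideal K R"
  proof (rule idealI_cring, goal_cases)
    case 2
    have "\<zero> \<odot>\<^bsub>?C 0\<^esub> ?z 0 = \<zero>\<^bsub>?C 0\<^esub>" by (rule module.smult_l_null[OF module_cochains[OF M] zc])
    then have "\<zero> \<odot>\<^bsub>?C 0\<^esub> ?z 0 \<in> ?B 0" by (simp only: B(2))
    then show ?case unfolding K_def by blast
  next
    case (3 s t)
    then obtain j k where jk: "s \<in> carrier R" "t \<in> carrier R" "s \<odot>\<^bsub>?C j\<^esub> ?z j \<in> ?B j" "t \<odot>\<^bsub>?C k\<^esub> ?z k \<in> ?B k"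
      unfolding K_def by blast
    interpret C: module R "?C (j + k)" by (rule module_cochains[OF M])
    have "t \<odot>\<^bsub>?C (j + k)\<^esub> ?z (j + k) \<in> ?B (j + k)"
      using mono[OF jk(4), of j] by (simp add: add.commute)
    then have "(s \<oplus> t) \<odot>\<^bsub>?C (j + k)\<^esub> ?z (j + k) \<in> ?B (j + k)"
      unfolding C.smult_l_distr[OF jk(1,2) zc] by (rule B(3)[OF mono[OF jk(3)]])
    then show ?case using jk(1,2) unfolding K_def by blast
  next
    case (4 r t)
    then obtain j where j: "t \<in> carrier R" "t \<odot>\<^bsub>?C j\<^esub> ?z j \<in> ?B j" unfolding K_def by blast
    interpret C: module R "?C j" by (rule module_cochains[OF M])
    have "(r \<otimes> t) \<odot>\<^bsub>?C j\<^esub> ?z j \<in> ?B j"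
      unfolding C.smult_assoc1[OF 4(1) j(1) zc] by (rule B(4)[OF 4(1) j(2)])
    then show ?case using 4(1) j(1) unfolding K_def by blast
  qed (auto simp: K_def)
  then have "K = carrier R"
  proof (rule gen)
    fix c u v assume c: "c \<in> carrier R" and u: "u \<in> module_homs R M N" and v: "v \<in> module_homs R N M"
      and vu: "\<And>m. m \<in> carrier M \<Longrightarrow> v (u m) = c \<odot>\<^bsub>M\<^esub> m"
    \<comment> \<open>The cocycle u z has values in N, so it becomes a coboundary at some stage.
      Applying \<open>v\<close> there returns c z as a coboundary with values in M.\<close>
    let ?uz = "\<lambda>x\<in>carrier (res_module R (P n) i). u (z x)"
    obtain j where j: "transition (pullback i) n j ?uz \<in> coboundaries R (P (n + j)) N i"
      using van postcompose_cocycle[OF M N u z] unfolding vanishing_def by blast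
    have "c \<odot>\<^bsub>?C j\<^esub> ?z j =
      (\<lambda>x\<in>carrier (res_module R (P (n + j)) i). v (transition (pullback i) n j ?uz x))"
      unfolding postcompose_transition using zc[of j]
      by (auto simp: cochains_def hom_module_simps vu module_homD(1) intro!: restrict_ext)
    then have "c \<odot>\<^bsub>?C j\<^esub> ?z j \<in> ?B j" using postcompose_coboundary[OF N M v j] by simp
    then show "c \<in> K" using c unfolding K_def by blast
  qed
  \<comment> \<open>Membership of 1 in \<open>K\<close> is the claim for \<open>z\<close>
    itself.\<close>
  then have "\<one> \<in> K" by simp
  then obtain j where "\<one> \<odot>\<^bsub>?C j\<^esub> ?z j \<in> ?B j" unfolding K_def by blast
  then show "\<exists>j. ?z j \<in> ?B j"
    using module.smult_one[OF module_cochains[OF M] zc] by metis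
qed

text \<open>Transitions of classes can be computed on representatives, and a class is zero iff its
  representative is a coboundary.\<close>

lemma zero_module_direct_limit_Ext_iff:
  assumes M: "module R M"
  shows "zero_module (direct_limit
    (\<lambda>n. quotient_module ((cochains R (P n) M i)\<lparr>carrier := cocycles R (P n) M i\<rparr>) (coboundaries R (P n) M i))
    (\<lambda>n X. \<Union>z\<in>X. coboundaries R (P (Suc n)) M i +>\<^bsub>cochains R (P (Suc n)) M i\<^esub> pullback i n z))
    \<longleftrightarrow> vanishing i M"
    (is "zero_module (direct_limit ?E ?f) \<longleftrightarrow> _")
proof -
  let ?C = "\<lambda>n. cochains R (P n) M i" and ?B = "\<lambda>n. coboundaries R (P n) M i"
  note C = module_cochains[OF M]
  note subB = submodule_coboundaries[OF M diff_hom]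
  note B = submoduleD[OF C subB]
  have cocycle: "z \<in> carrier (?C n)" if "z \<in> cocycles R (P n) M i" for n z
    using that by (simp add: cocycles_iff cochains_def hom_module_simps)
  \<comment> \<open>Cosets depend only on addition, so those formed inside the cocycles agree with
    those formed among all cochains.\<close>
  have car: "carrier (?E n) = (\<lambda>z. ?B n +>\<^bsub>?C n\<^esub> z) ` cocycles R (P n) M i" for n
    by (auto simp: quotient_module_def A_RCOSETS_def' a_r_coset_def')
  have zero: "\<zero>\<^bsub>?E n\<^esub> = ?B n" for n by (simp add: quotient_module_def)
  \<comment> \<open>The union runs over equal cosets: pulling back is additive and sends
    coboundaries to coboundaries.\<close>
  have map: "?f n (?B n +>\<^bsub>?C n\<^esub> z) = ?B (Suc n) +>\<^bsub>?C (Suc n)\<^esub> pullback i n z"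
    if z: "z \<in> carrier (?C n)" for n z
  proof -
    interpret C0: module R "?C n" by (rule C)
    interpret C1: module R "?C (Suc n)" by (rule C)
    interpret A0: abelian_subgroup "?B n" "?C n"
      by (rule abelian_subgroupI3[OF _ C0.M.abelian_group_axioms])
         (rule additive_subgroup.intro[OF submodule.axioms(1)[OF subB]])
    interpret A1: abelian_subgroup "?B (Suc n)" "?C (Suc n)"
      by (rule abelian_subgroupI3[OF _ C1.M.abelian_group_axioms])
         (rule additive_subgroup.intro[OF submodule.axioms(1)[OF subB]])
    have "?B (Suc n) +>\<^bsub>?C (Suc n)\<^esub> pullback i n y = ?B (Suc n) +>\<^bsub>?C (Suc n)\<^esub> pullback i n z"
      if y: "y \<in> ?B n +>\<^bsub>?C n\<^esub> z" for y
    proof -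
      obtain b where b: "b \<in> ?B n" "y = b \<oplus>\<^bsub>?C n\<^esub> z" using y by (auto simp: a_r_coset_def')
      then have "pullback i n y \<in> ?B (Suc n) +>\<^bsub>?C (Suc n)\<^esub> pullback i n z"
        using pullback_coboundary[OF b(1)] by (auto simp: pullback_add a_r_coset_def')
      then show ?thesis
        using A1.a_repr_independence' pullback_closed[OF z] by metis
    qed
    moreover have "z \<in> ?B n +>\<^bsub>?C n\<^esub> z" by (rule A0.a_rcos_self[OF z])
    ultimately show ?thesis by blast
  qed
  have coset_zero: "?B n +>\<^bsub>?C n\<^esub> \<zero>\<^bsub>?C n\<^esub> = ?B n" for n
    using coset_eq_submodule_iff[OF C subB] B(1,2) by blast
  have f0: "?f n \<zero>\<^bsub>?E n\<^esub> = \<zero>\<^bsub>?E (Suc n)\<^esub>" for n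
    using map[of "\<zero>\<^bsub>?C n\<^esub>" n] B(1,2) unfolding zero coset_zero pullback_zero by blast
  have "\<zero>\<^bsub>?C 0\<^esub> \<in> carrier (?C 0)" using B(1,2) by blast
  then have "\<zero>\<^bsub>?C 0\<^esub> \<in> cocycles R (P 0) M i"
    by (auto simp: cocycles_iff codiff_def cochains_def hom_module_simps diff_closed
        intro!: restrict_ext)
  then have z0: "\<zero>\<^bsub>?E 0\<^esub> \<in> carrier (?E 0)" unfolding zero car using coset_zero by blast
  have trans: "transition ?f n j (?B n +>\<^bsub>?C n\<^esub> z) = ?B (n + j) +>\<^bsub>?C (n + j)\<^esub> transition (pullback i) n j z"
    if z: "z \<in> cocycles R (P n) M i" for n j z
  proof (induction j)
    case (Suc j)
    then show ?case using map[OF cocycle[OF transition_cocycle[OF z, of j]]] by simp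
  qed simp
  have "transition ?f n j (?B n +>\<^bsub>?C n\<^esub> z) = \<zero>\<^bsub>?E (n + j)\<^esub> \<longleftrightarrow> transition (pullback i) n j z \<in> ?B (n + j)"
    if z: "z \<in> cocycles R (P n) M i" for n j z
    unfolding trans[OF z] zero
    by (rule coset_eq_submodule_iff[OF C subB cocycle[OF transition_cocycle[OF z]]])
  then show ?thesis
    unfolding zero_module_direct_limit_iff[of ?f ?E, OF f0 z0] car vanishing_def by simp
qed

end

section \<open>Local cohomology as the limit over a tower\<close>

lemma resolution_tower_power_quotient:
  fixes R :: "('a, 'c) ring_scheme"
  assumes R: "cring R" "noetherian_ring R" "ideal \<aa> R"
  defines "P \<equiv> \<lambda>n. the_resolution R (power_quotient R \<aa> n)"
  shows "resolution_tower R P (\<lambda>n. the_lift R (P (Suc n)) (P n) (power_proj R \<aa> n))"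
proof (intro resolution_tower.intro resolution_tower_axioms.intro R(1))
  note l = the_lift_power_proj[OF R, folded P_def, unfolded chain_lift_def]
  fix n k
  show "diff (P n) k \<in> module_homs R (res_module R (P n) (Suc k)) (res_module R (P n) k)"
    using the_resolution_power_quotient[OF R, of n] unfolding P_def free_resolution_def by blast
  show "the_lift R (P (Suc n)) (P n) (power_proj R \<aa> n) k \<in>
      module_homs R (res_module R (P (Suc n)) k) (res_module R (P n) k)"
    using l[of n] unfolding P_def by blast
  show "diff (P n) k (the_lift R (P (Suc n)) (P n) (power_proj R \<aa> n) (Suc k) x) =
      the_lift R (P (Suc n)) (P n) (power_proj R \<aa> n) k (diff (P (Suc n)) k x)"
    if "x \<in> carrier (res_module R (P (Suc n)) (Suc k))" for x
    using l[of n] that unfolding P_def by blast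
qed

text \<open>Unfolding \<open>Ext\<close> and \<open>Ext_map\<close> for the chosen resolutions gives
  exactly the quotients and maps of \<open>zero_module_direct_limit_Ext_iff\<close>.\<close>

lemma zero_local_cohomology_iff:
  fixes R :: "('a, 'c) ring_scheme"
  assumes R: "cring R" "noetherian_ring R" "ideal \<aa> R" and M: "module R M"
  defines "P \<equiv> \<lambda>n. the_resolution R (power_quotient R \<aa> n)"
  shows "zero_module (local_cohomology R \<aa> i M) \<longleftrightarrow>
    resolution_tower.vanishing R P (\<lambda>n. the_lift R (P (Suc n)) (P n) (power_proj R \<aa> n)) i M"
proof -
  interpret resolution_tower R P "\<lambda>n. the_lift R (P (Suc n)) (P n) (power_proj R \<aa> n)"
    unfolding P_def by (rule resolution_tower_power_quotient[OF R])
  have E: "Ext R i (power_quotient R \<aa> n) M = quotient_module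
      ((cochains R (P n) M i)\<lparr>carrier := cocycles R (P n) M i\<rparr>) (coboundaries R (P n) M i)" for n
    by (simp add: Ext_def P_def Let_def)
  have f: "Ext_map R i (power_quotient R \<aa> (Suc n)) (power_quotient R \<aa> n) M (power_proj R \<aa> n) =
      (\<lambda>X. \<Union>z\<in>X. coboundaries R (P (Suc n)) M i +>\<^bsub>cochains R (P (Suc n)) M i\<^esub> pullback i n z)" for n
    unfolding pullback_def by (rule ext) (simp add: Ext_map_def P_def Let_def)
  show ?thesis
    unfolding local_cohomology_def E f by (rule zero_module_direct_limit_Ext_iff[OF M])
qed

text \<open>The modules M and N are tested against the same tower, so
  \<open>vanishing_transfer\<close> applies to their local cohomology.\<close>

lemma zero_local_cohomology_transfer:
  assumes R: "cring R" "noetherian_ring R" "ideal \<aa> R" and M: "module R M" and N: "module R N"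
    and gen: "\<And>K. ideal K R \<Longrightarrow> (\<And>c u v. c \<in> carrier R \<Longrightarrow> u \<in> module_homs R M N \<Longrightarrow>
      v \<in> module_homs R N M \<Longrightarrow> (\<And>m. m \<in> carrier M \<Longrightarrow> v (u m) = c \<odot>\<^bsub>M\<^esub> m) \<Longrightarrow> c \<in> K) \<Longrightarrow> K = carrier R"
    and zero: "zero_module (local_cohomology R \<aa> i N)"
  shows "zero_module (local_cohomology R \<aa> i M)"
proof -
  interpret resolution_tower R "\<lambda>n. the_resolution R (power_quotient R \<aa> n)"
    "\<lambda>n. the_lift R (the_resolution R (power_quotient R \<aa> (Suc n)))
      (the_resolution R (power_quotient R \<aa> n)) (power_proj R \<aa> n)"
    by (rule resolution_tower_power_quotient[OF R])
  show ?thesis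
    using zero vanishing_transfer[OF M N _ gen, of i]
    unfolding zero_local_cohomology_iff[OF R M] zero_local_cohomology_iff[OF R N] by blast
qed


section \<open>Relative Cohen-Macaulayness\<close>

text \<open>Multiplication by the square of a cyclic scalar factors through R on M and through M on
  R. These squares generate the unit ideal, so vanishing transfers both ways.\<close>

lemma zero_local_cohomology_faithful_multiplication_iff:
  assumes R: "cring R" "noetherian_ring R" "ideal \<aa> R" and fm: "faithful_multiplication_module R M"
  shows "zero_module (local_cohomology R \<aa> i M) \<longleftrightarrow>
    zero_module (local_cohomology R \<aa> i (self_module R))"
proof -
  have M: "module R M" and ann: "annihilator R M = {\<zero>\<^bsub>R\<^esub>}"
    using fm by (auto simp: faithful_multiplication_module_def multiplication_module_def)
  interpret module R M by fact
  note S = module_self_module[OF R(1)]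
  have sq: "a \<otimes>\<^bsub>R\<^esub> a \<in> carrier R" if "a \<in> cyclic_scalars R M x" for a x
    using that by (simp add: cyclic_scalars_def)
  show ?thesis
  proof
    assume "zero_module (local_cohomology R \<aa> i M)"
    then show "zero_module (local_cohomology R \<aa> i (self_module R))"
    proof (rule zero_local_cohomology_transfer[OF R S M, rotated])
      fix K assume K: "ideal K R" and factor: "\<And>c u v. c \<in> carrier R \<Longrightarrow>
        u \<in> module_homs R (self_module R) M \<Longrightarrow> v \<in> module_homs R M (self_module R) \<Longrightarrow>
        (\<And>m. m \<in> carrier (self_module R) \<Longrightarrow> v (u m) = c \<odot>\<^bsub>self_module R\<^esub> m) \<Longrightarrow> c \<in> K"
      show "K = carrier R"
      proof (rule faithful_multiplication_module_cyclic_scalars[OF R(1,2) fm K])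
        fix x a assume x: "x \<in> carrier M" and a: "a \<in> cyclic_scalars R M x"
        obtain f g where "f \<in> module_homs R M (self_module R)" "g \<in> module_homs R (self_module R) M"
          "\<forall>m\<in>carrier M. g (f m) = (a \<otimes>\<^bsub>R\<^esub> a) \<odot>\<^bsub>M\<^esub> m"
          "\<forall>r\<in>carrier R. f (g r) = (a \<otimes>\<^bsub>R\<^esub> a) \<otimes>\<^bsub>R\<^esub> r"
          by (rule cyclic_scalars_maps[OF M ann x a])
        \<comment> \<open>On R the factorization is f after g; the converse direction uses g after f
          on M.\<close>
        then show "a \<otimes>\<^bsub>R\<^esub> a \<in> K"
          using sq[OF a] by (intro factor[of _ g f]) (auto simp: self_module_def)
      qed
    qed
  next
    assume "zero_module (local_cohomology R \<aa> i (self_module R))"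
    then show "zero_module (local_cohomology R \<aa> i M)"
    proof (rule zero_local_cohomology_transfer[OF R M S, rotated])
      fix K assume K: "ideal K R" and factor: "\<And>c u v. c \<in> carrier R \<Longrightarrow>
        u \<in> module_homs R M (self_module R) \<Longrightarrow> v \<in> module_homs R (self_module R) M \<Longrightarrow>
        (\<And>m. m \<in> carrier M \<Longrightarrow> v (u m) = c \<odot>\<^bsub>M\<^esub> m) \<Longrightarrow> c \<in> K"
      show "K = carrier R"
      proof (rule faithful_multiplication_module_cyclic_scalars[OF R(1,2) fm K])
        fix x a assume x: "x \<in> carrier M" and a: "a \<in> cyclic_scalars R M x"
        obtain f g where "f \<in> module_homs R M (self_module R)" "g \<in> module_homs R (self_module R) M"
          "\<forall>m\<in>carrier M. g (f m) = (a \<otimes>\<^bsub>R\<^esub> a) \<odot>\<^bsub>M\<^esub> m"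
          "\<forall>r\<in>carrier R. f (g r) = (a \<otimes>\<^bsub>R\<^esub> a) \<otimes>\<^bsub>R\<^esub> r"
          by (rule cyclic_scalars_maps[OF M ann x a])
        then show "a \<otimes>\<^bsub>R\<^esub> a \<in> K"
          using sq[OF a] by (intro factor[of _ f g]) auto
      qed
    qed
  qed
qed

theorem corollary3p2:
  fixes R :: "('a, 'c) ring_scheme" and \<aa> :: "'a set" and M :: "('a, 'b, 'd) module_scheme"
  assumes "cring R"
    and "noetherian_ring R"
    and "ideal \<aa> R"
    and "\<aa> \<noteq> carrier R"
    and "faithful_multiplication_module R M"
  shows "relative_cohen_macaulay R \<aa> M \<longleftrightarrow> relative_cohen_macaulay R \<aa> (self_module R)"
proof -
  have mult: "multiplication_module R M" and M: "module R M"
    using assms(5) by (auto simp: faithful_multiplication_module_def multiplication_module_def)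
  \<comment> \<open>Both modules are finitely generated, so only the uniqueness of the nonvanishing
    degree remains, and the two conditions agree degree by degree.\<close>
  show ?thesis
    unfolding relative_cohen_macaulay_def
      zero_local_cohomology_faithful_multiplication_iff[OF assms(1-3,5)]
    using M multiplication_module_fin_gen[OF assms(1,2) mult]
      module_self_module[OF assms(1)] fin_gen_self_module[OF assms(1)] by simp
qed

end
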